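(* Let $f:\mathbb{R}^n\times\mathbb{R}^m\to\mathbb{R}^n$ be Lipschitz continuous with $f(0,0)=0$, and consider the control system $\dot x=f(x,u)$, $(x,u)\in\mathbb{R}^n\times\mathbb{R}^m$. Suppose that there exist a continuous, positive definite and proper function $V:\mathbb{R}^n\to\mathbb{R}^+$ and a function $a\in K$ such that for every $\xi>0$ and every $x_0\neq 0$ there exist a constant $\varepsilon=\varepsilon(x_0)\in(0,\xi]$ and a measurable and locally essentially bounded control $u(\cdot,x_0):[0,\varepsilon]\to\mathbb{R}^m$ satisfying $$V(x(\varepsilon,0,x_0,u(\cdot,x_0)))<V(x_0)$$ and $$V(x(s,0,x_0,u(\cdot,x_0)))\le a(V(x_0))\quad\text{for all } s\in[0,\varepsilon].$$ Then the system $\dot x=f(x,u)$ is Semi-Globally Asymptotically Stabilizable by Sampled-Data Feedback (SDF-SGAS).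
   Context: Notation: $\mathbb{R}^+=[0,\infty)$; $|x|$ is the Euclidean norm. The class $K$ consists of the functions $a:\mathbb{R}^+\to\mathbb{R}^+$ that are continuous and strictly increasing with $a(0)=0$. A function $V:\mathbb{R}^n\to\mathbb{R}^+$ is positive definite if $V(0)=0$ and $V(x)>0$ for $x\ne0$, and proper if its sublevel sets $\{x: V(x)\le c\}$ are compact. $x(\cdot,s,x_0,u)$ denotes the trajectory of $\dot x=f(x,u)$ with initial condition $x(s,s,x_0,u)=x_0$ corresponding to a measurable and locally essentially bounded control $u:[s,T_{\max})\to\mathbb{R}^m$, where $T_{\max}=T_{\max}(s,x_0,u)$ is the maximal existence time of the trajectory. (The hypothesis includes that the trajectory exists on $[0,\varepsilon]$.) Definition (SDF-SGAS). The system $\dot x=f(x,u)$ is Semi-Globally Asymptotically Stabilizable by Sampled-Data Feedback if for every $R>0$ and for any given partition of times $T_1:=0<T_2<T_3<\dots<T_\nu<\dots$ with $T_\nu\to\infty$, there exist a neighborhood $\Pi$ of zero with $B[0,R]:=\{x\in\mathbb{R}^n:|x|\le R\}\subset\Pi$ and a map $k:\mathbb{R}^+\times\Pi\to\mathbb{R}^m$ such that for any $x\in\Pi$ the map $k(\cdot,x):\mathbb{R}^+\to\mathbb{R}^m$ is measurable and locally essentially bounded, and the trajectory $x(\cdot)$ of the sampled-data closed-loop system $$\dot x=f(x,k(t,x(T_i))),\quad t\in[T_i,T_{i+1}),\ i=1,2,\dots,\qquad x(0)\in\Pi,$$ satisfies: - Stability: for every $\varepsilon>0$ there exists $\delta=\delta(\varepsilon)>0$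 such that $x(0)\in\Pi$, $|x(0)|\le\delta$ implies $|x(t)|\le\varepsilon$ for all $t\ge0$; - Attractivity: $\lim_{t\to\infty}x(t)=0$ for all $x(0)\in\Pi$. *)

theory Defs
  imports "HOL-Analysis.Analysis"
begin

definition class_K :: "(real \<Rightarrow> real) \<Rightarrow> bool" where
  "class_K a \<longleftrightarrow> continuous_on {0..} a \<and> strict_mono_on {0..} a \<and> a 0 = 0"

definition positive_definite :: "('a::zero \<Rightarrow> real) \<Rightarrow> bool" where
  "positive_definite V \<longleftrightarrow> V 0 = 0 \<and> (\<forall>x. x \<noteq> 0 \<longrightarrow> V x > 0)"

definition proper_function :: "('a::topological_space \<Rightarrow> real) \<Rightarrow> bool" where
  "proper_function V \<longleftrightarrow> (\<forall>c. compact {x. V x \<le> c})"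

text \<open>Lebesgue measurable and locally essentially bounded on \<open>I\<close>.\<close>

definition admissible_control :: "real set \<Rightarrow> (real \<Rightarrow> 'b::euclidean_space) \<Rightarrow> bool" where
  "admissible_control I u \<longleftrightarrow>
     u \<in> borel_measurable (lebesgue_on I) \<and>
     (\<forall>C. compact C \<and> C \<subseteq> I \<longrightarrow> (\<exists>M. AE t in lebesgue_on C. norm (u t) \<le> M))"

text \<open>Caratheodory solutions of \<open>x' = f (x, u)\<close>, \<open>x s = x0\<close>, on the compact interval from
  \<open>s\<close> to \<open>T\<close>: the integral equation says that \<open>x\<close> is absolutely continuous there and satisfies
  the differential equation almost everywhere. For locally Lipschitz \<open>f\<close> and admissible \<open>u\<close>
  there is at most one such \<open>x\<close> on the interval, so "a trajectory" is "the trajectory".\<close>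

definition trajectory_on ::
  "('a::euclidean_space \<times> 'b \<Rightarrow> 'a) \<Rightarrow> real \<Rightarrow> real \<Rightarrow> 'a \<Rightarrow> (real \<Rightarrow> 'b) \<Rightarrow> (real \<Rightarrow> 'a) \<Rightarrow> bool" where
  "trajectory_on f s T x0 u x \<longleftrightarrow>
     (\<lambda>\<tau>. f (x \<tau>, u \<tau>)) absolutely_integrable_on {s..T} \<and>
     (\<forall>t\<in>{s..T}. x t = x0 + integral {s..t} (\<lambda>\<tau>. f (x \<tau>, u \<tau>)))"

definition time_partition :: "(nat \<Rightarrow> real) \<Rightarrow> bool" where
  "time_partition T \<longleftrightarrow> T 0 = 0 \<and> strict_mono T \<and> filterlim T at_top sequentially"

text \<open>A solution, defined for all \<open>t \<ge> 0\<close>, of the closed-loop system that holds the sample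
  \<open>x (T i)\<close> between \<open>T i\<close> and \<open>T (Suc i)\<close>. The feedback is only defined for states in \<open>P\<close>, so
  all samples must lie in \<open>P\<close>; in particular \<open>x 0 \<in> P\<close>.\<close>

definition sampled_trajectory ::
  "('a::euclidean_space \<times> 'b \<Rightarrow> 'a) \<Rightarrow> (nat \<Rightarrow> real) \<Rightarrow> 'a set \<Rightarrow> (real \<Rightarrow> 'a \<Rightarrow> 'b) \<Rightarrow> (real \<Rightarrow> 'a) \<Rightarrow> bool" where
  "sampled_trajectory f T P k x \<longleftrightarrow>
     (\<forall>i. x (T i) \<in> P \<and>
          trajectory_on f (T i) (T (Suc i)) (x (T i)) (\<lambda>t. k t (x (T i))) x)"

definition SDF_SGAS :: "('a::euclidean_space \<times> 'b::euclidean_space \<Rightarrow> 'a) \<Rightarrow> bool" where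
  "SDF_SGAS f \<longleftrightarrow>
     (\<forall>R>0. \<forall>T. time_partition T \<longrightarrow>
       (\<exists>P k. 0 \<in> interior P \<and> cball 0 R \<subseteq> P \<and>
         (\<forall>x\<in>P. admissible_control {0..} (\<lambda>t. k t x)) \<and>
         (\<forall>x0\<in>P. \<exists>x. sampled_trajectory f T P k x \<and> x 0 = x0) \<and>
         (\<forall>\<epsilon>>0. \<exists>\<delta>>0. \<forall>x. sampled_trajectory f T P k x \<and> norm (x 0) \<le> \<delta> \<longrightarrow>
            (\<forall>t\<ge>0. norm (x t) \<le> \<epsilon>)) \<and>
         (\<forall>x. sampled_trajectory f T P k x \<longrightarrow> (x \<longlongrightarrow> 0) at_top)))"

end

theory Submission
  imports Defs
begin

text \<open>
  Perturbing the initial state of the controls given by the hypothesis and using compactness of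
  \<open>{y. r \<le> V y \<and> V y \<le> c}\<close>, one gets controls of length at most 1 that decrease \<open>V\<close> by a fixed
  amount on that set, while \<open>V\<close> stays below \<open>a c + c\<close>. Concatenating them yields, from every initial
  state in a sublevel set, a control on the half line whose trajectory satisfies one common decay
  bound in \<open>t\<close> and an overshoot bound that vanishes with the initial value of \<open>V\<close>.

  Decreasing \<open>V\<close> from one sample to the next would not suffice: on short sampling intervals the
  possible decrease may be too small to sum up. Instead, the feedback follows at each sample
  \<open>(T i, y)\<close> an open-loop plan starting at \<open>(T i, y)\<close> that respects the decay bound in absolute
  time, and among those one with the smallest overshoot bound. The tail of that plan is again a
  plan from the next sample, so the bounds are never lost, although the plan may change at every
  sample.
\<close>


subsection \<open>Controls\<close>

text \<open>Coordinatewise, a Lebesgue measurable function agrees with a Borel one off a null set;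
  truncating where the essential bound fails makes the bound hold everywhere. Later estimates can
  then use pointwise bounds, after a single exchange of controls.\<close>

lemma admissible_control_borelE:
  fixes u :: "real \<Rightarrow> 'b::euclidean_space"
  assumes "admissible_control {s..T} u"
  obtains v M where "v \<in> borel_measurable borel" "\<And>t. norm (v t) \<le> M"
    "negligible {t\<in>{s..T}. u t \<noteq> v t}"
proof -
  from assms have um: "u \<in> borel_measurable (lebesgue_on {s..T})"
    by (simp add: admissible_control_def)
  from assms obtain M where M: "AE t in lebesgue_on {s..T}. norm (u t) \<le> M"
    unfolding admissible_control_def by (meson compact_Icc order_refl)
  define w where "w t = (if t \<in> {s..T} then u t else 0)" for t
  have wm: "w \<in> borel_measurable lebesgue"
    unfolding w_def using um by (subst borel_measurable_if) auto
  have "\<forall>b\<in>Basis. \<exists>g\<in>borel_measurable lborel. AE t in lborel. w t \<bullet> b = g t"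
    using wm by (intro ballI completion_ex_borel_measurable_real) auto
  then obtain g where g: "\<And>b. b \<in> Basis \<Longrightarrow> g b \<in> borel_measurable lborel"
    "\<And>b. b \<in> Basis \<Longrightarrow> AE t in lborel. w t \<bullet> b = g b t"
    by metis
  define v0 where "v0 t = (\<Sum>b\<in>Basis. g b t *\<^sub>R b)" for t
  have v0m: "v0 \<in> borel_measurable borel"
    unfolding v0_def using g(1) by (intro borel_measurable_sum borel_measurable_scaleR) auto
  have "AE t in lborel. \<forall>b\<in>Basis. w t \<bullet> b = g b t"
    using g(2) by (intro AE_finite_allI) auto
  then have "AE t in lborel. w t = v0 t"
    by eventually_elim (simp add: v0_def euclidean_eq_iff[where 'a='b])
  then have wv: "AE t in lebesgue. w t = v0 t"
    by (rule AE_completion)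
  have "AE t in lebesgue. t \<in> {s..T} \<longrightarrow> norm (u t) \<le> M"
    using M by (subst (asm) AE_restrict_space_iff) auto
  with wv have "AE t in lebesgue. \<not> (t \<in> {s..T} \<and> (u t \<noteq> v0 t \<or> norm (u t) > M))"
    by eventually_elim (auto simp: w_def)
  then have neg: "negligible {t \<in> {s..T}. u t \<noteq> v0 t \<or> norm (u t) > M}"
    unfolding negligible_iff_null_sets AE_iff_null_sets
    by (auto simp: eventually_ae_filter negligible_iff_null_sets intro: null_sets_completion_subset)
  define v where "v t = (if norm (v0 t) \<le> M then v0 t else 0)" for t
  show thesis
  proof
    show "v \<in> borel_measurable borel"
      unfolding v_def using v0m by measurable
    \<comment> \<open>If the interval is null, the essential bound \<open>M\<close> may be negative,
      while \<open>v\<close> takes the value 0.\<close>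
    show "norm (v t) \<le> max M 0" for t
      by (auto simp: v_def le_max_iff_disj)
    show "negligible {t \<in> {s..T}. u t \<noteq> v t}"
      by (rule negligible_subset[OF neg]) (auto simp: v_def)
  qed
qed

text \<open>Converse of the extraction above: on a compact interval, admissibility amounts to having
  a bounded Borel representative. Exchanging, translating and joining controls can therefore be
  checked on Borel functions.\<close>

lemma borel_admissible_control:
  fixes u v :: "real \<Rightarrow> 'b::euclidean_space"
  assumes "v \<in> borel_measurable borel" "\<And>t. norm (v t) \<le> M"
    "negligible {t\<in>{s..T}. u t \<noteq> v t}"
  shows "admissible_control {s..T} u"
  unfolding admissible_control_def
proof (intro conjI allI impI)
  let ?N = "{t\<in>{s..T}. u t \<noteq> v t}"
  have null: "?N \<in> null_sets lebesgue"
    using assms(3) by (simp add: negligible_iff_null_sets)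
  have ae: "AE t in lebesgue. t \<in> {s..T} \<longrightarrow> v t = u t"
    using AE_not_in[OF null] by eventually_elim auto
  have "(\<lambda>t. if t \<in> {s..T} then u t else 0) \<in> borel_measurable lebesgue"
  proof (rule borel_measurable_AE)
    have "(\<lambda>t. if t \<in> {s..T} then v t else 0) \<in> borel_measurable borel"
      using assms(1) by measurable
    then show "(\<lambda>t. if t \<in> {s..T} then v t else 0) \<in> borel_measurable lebesgue"
      by (simp add: measurable_completion)
    show "AE t in lebesgue. (if t \<in> {s..T} then v t else 0) = (if t \<in> {s..T} then u t else 0)"
      using ae by eventually_elim auto
  qed
  then show "u \<in> borel_measurable (lebesgue_on {s..T})"
    by (subst (asm) borel_measurable_if) auto
  fix C :: "real set" assume C: "compact C \<and> C \<subseteq> {s..T}"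
  show "\<exists>M. AE t in lebesgue_on C. norm (u t) \<le> M"
  proof
    have "C \<in> sets lebesgue"
      using C by (simp add: borel_compact)
    then show "AE t in lebesgue_on C. norm (u t) \<le> M"
    proof (subst AE_restrict_space_iff)
      show "AE t in lebesgue. t \<in> C \<longrightarrow> norm (u t) \<le> M"
        using ae by eventually_elim (use C assms(2) in \<open>metis subsetD\<close>)
    qed simp
  qed
qed

lemma admissible_control_subinterval:
  fixes u :: "real \<Rightarrow> 'b::euclidean_space"
  assumes "admissible_control I u" "{s..T} \<subseteq> I" "I \<in> sets lebesgue"
  shows "admissible_control {s..T} u"
  unfolding admissible_control_def
proof (intro conjI allI impI)
  have "u \<in> borel_measurable (lebesgue_on I)"
    using assms(1) by (simp add: admissible_control_def)
  then show "u \<in> borel_measurable (lebesgue_on {s..T})"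
    by (rule measurable_restrict_mono[OF _ assms(2)])
  fix C assume "compact C \<and> C \<subseteq> {s..T}"
  then show "\<exists>M. AE t in lebesgue_on C. norm (u t) \<le> M"
    using assms(1,2) unfolding admissible_control_def by blast
qed

lemma admissible_control_spike:
  fixes u w :: "real \<Rightarrow> 'b::euclidean_space"
  assumes "admissible_control {s..T} u" "negligible N" "\<And>t. t \<in> {s..T} - N \<Longrightarrow> w t = u t"
  shows "admissible_control {s..T} w"
proof -
  obtain v M where v: "v \<in> borel_measurable borel" "\<And>t. norm (v t) \<le> M"
    "negligible {t\<in>{s..T}. u t \<noteq> v t}"
    using admissible_control_borelE[OF assms(1)] by blast
  have "negligible {t\<in>{s..T}. w t \<noteq> v t}"
    by (rule negligible_subset[OF negligible_Un[OF v(3) assms(2)]]) (use assms(3) in force)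
  then show ?thesis
    using borel_admissible_control v by blast
qed

lemma admissible_control_shift:
  fixes u :: "real \<Rightarrow> 'b::euclidean_space"
  assumes "admissible_control {s..T} u"
  shows "admissible_control {s - c..T - c} (\<lambda>t. u (t + c))"
proof -
  obtain v M where v: "v \<in> borel_measurable borel" "\<And>t. norm (v t) \<le> M"
    "negligible {t\<in>{s..T}. u t \<noteq> v t}"
    using admissible_control_borelE[OF assms] by blast
  show ?thesis
  proof (rule borel_admissible_control)
    show "(\<lambda>t. v (t + c)) \<in> borel_measurable borel"
      using v(1) by measurable
    show "norm (v (t + c)) \<le> M" for t by (rule v(2))
    show "negligible {t \<in> {s - c..T - c}. u (t + c) \<noteq> v (t + c)}"
    proof (rule negligible_subset[OF negligible_translation[OF v(3), of "- c"]], rule subsetI)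
      fix t assume "t \<in> {t \<in> {s - c..T - c}. u (t + c) \<noteq> v (t + c)}"
      then have "t + c \<in> {t \<in> {s..T}. u t \<noteq> v t}" "t = - c + (t + c)"
        by auto
      then show "t \<in> (+) (- c) ` {t \<in> {s..T}. u t \<noteq> v t}"
        by (rule rev_image_eqI)
    qed
  qed
qed

lemma admissible_control_join:
  fixes u :: "real \<Rightarrow> 'b::euclidean_space"
  assumes "admissible_control {s..m} u" "admissible_control {m..T} u"
  shows "admissible_control {s..T} u"
proof -
  obtain v M where v: "v \<in> borel_measurable borel" "\<And>t. norm (v t) \<le> M"
    "negligible {t\<in>{s..m}. u t \<noteq> v t}"
    using admissible_control_borelE[OF assms(1)] by blast
  obtain w K where w: "w \<in> borel_measurable borel" "\<And>t. norm (w t) \<le> K"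
    "negligible {t\<in>{m..T}. u t \<noteq> w t}"
    using admissible_control_borelE[OF assms(2)] by blast
  show ?thesis
  proof (rule borel_admissible_control)
    show "(\<lambda>t. if t \<le> m then v t else w t) \<in> borel_measurable borel"
      using v(1) w(1) by measurable
    show "norm (if t \<le> m then v t else w t) \<le> max M K" for t
      using v(2)[of t] w(2)[of t] by auto
    show "negligible {t \<in> {s..T}. u t \<noteq> (if t \<le> m then v t else w t)}"
      by (rule negligible_subset[OF negligible_Un[OF v(3) w(3)]]) auto
  qed
qed

subsection \<open>Trajectories\<close>

lemma trajectory_on_initial: "trajectory_on f s T x0 u x \<Longrightarrow> s \<le> T \<Longrightarrow> x s = x0"
  by (simp add: trajectory_on_def)

lemma trajectory_on_continuous:
  assumes "trajectory_on f s T x0 u x"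
  shows "continuous_on {s..T} x"
proof -
  have "continuous_on {s..T} (\<lambda>t. x0 + integral {s..t} (\<lambda>\<tau>. f (x \<tau>, u \<tau>)))"
    using assms unfolding trajectory_on_def
    by (intro continuous_intros indefinite_integral_continuous_1 set_lebesgue_integral_eq_integral(1)) auto
  then show ?thesis
    using assms unfolding trajectory_on_def by (metis (no_types, lifting) continuous_on_cong)
qed

lemma trajectory_on_subinterval:
  assumes tr: "trajectory_on f s T x0 u x" and le: "s \<le> s'" "T' \<le> T"
  shows "trajectory_on f s' T' (x s') u x"
  unfolding trajectory_on_def
proof (intro conjI ballI)
  have ai: "(\<lambda>\<tau>. f (x \<tau>, u \<tau>)) absolutely_integrable_on {s..T}"
    and eq: "\<And>t. t \<in> {s..T} \<Longrightarrow> x t = x0 + integral {s..t} (\<lambda>\<tau>. f (x \<tau>, u \<tau>))"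
    using tr by (auto simp: trajectory_on_def)
  show "(\<lambda>\<tau>. f (x \<tau>, u \<tau>)) absolutely_integrable_on {s'..T'}"
    using ai by (rule absolutely_integrable_on_subinterval) (use le in auto)
  fix t assume t: "t \<in> {s'..T'}"
  have "(\<lambda>\<tau>. f (x \<tau>, u \<tau>)) integrable_on {s..t}"
    using ai t le by (intro set_lebesgue_integral_eq_integral(1) absolutely_integrable_on_subinterval[OF ai]) auto
  then have "integral {s..s'} (\<lambda>\<tau>. f (x \<tau>, u \<tau>)) + integral {s'..t} (\<lambda>\<tau>. f (x \<tau>, u \<tau>))
      = integral {s..t} (\<lambda>\<tau>. f (x \<tau>, u \<tau>))"
    using t le by (intro Henstock_Kurzweil_Integration.integral_combine) auto
  then show "x t = x s' + integral {s'..t} (\<lambda>\<tau>. f (x \<tau>, u \<tau>))"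
    using eq[of t] eq[of s'] t le by (simp add: algebra_simps flip: add.assoc)
qed

lemma trajectory_on_join:
  assumes tr1: "trajectory_on f s m x0 u x" and tr2: "trajectory_on f m T (x m) u x"
    and le: "s \<le> m" "m \<le> T"
  shows "trajectory_on f s T x0 u x"
  unfolding trajectory_on_def
proof (intro conjI ballI)
  have ai1: "(\<lambda>\<tau>. f (x \<tau>, u \<tau>)) absolutely_integrable_on {s..m}"
    and ai2: "(\<lambda>\<tau>. f (x \<tau>, u \<tau>)) absolutely_integrable_on {m..T}"
    using tr1 tr2 by (auto simp: trajectory_on_def)
  show ai: "(\<lambda>\<tau>. f (x \<tau>, u \<tau>)) absolutely_integrable_on {s..T}"
    using absolutely_integrable_on_combine[OF ai1 ai2 le] .
  fix t assume t: "t \<in> {s..T}"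
  show "x t = x0 + integral {s..t} (\<lambda>\<tau>. f (x \<tau>, u \<tau>))"
  proof (cases "t \<le> m")
    case True
    then show ?thesis using tr1 t by (simp add: trajectory_on_def)
  next
    case False
    have "(\<lambda>\<tau>. f (x \<tau>, u \<tau>)) integrable_on {s..t}"
      using t by (intro set_lebesgue_integral_eq_integral(1) absolutely_integrable_on_subinterval[OF ai]) auto
    then have "integral {s..m} (\<lambda>\<tau>. f (x \<tau>, u \<tau>)) + integral {m..t} (\<lambda>\<tau>. f (x \<tau>, u \<tau>))
        = integral {s..t} (\<lambda>\<tau>. f (x \<tau>, u \<tau>))"
      using False le by (intro Henstock_Kurzweil_Integration.integral_combine) auto
    moreover have "x m = x0 + integral {s..m} (\<lambda>\<tau>. f (x \<tau>, u \<tau>))"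
      "x t = x m + integral {m..t} (\<lambda>\<tau>. f (x \<tau>, u \<tau>))"
      using tr1 tr2 t False le by (auto simp: trajectory_on_def)
    ultimately show ?thesis by (simp add: algebra_simps flip: add.assoc)
  qed
qed

text \<open>The integral equation does not see null sets of times. So a control may be replaced by
  its Borel representative, and its values at breakpoints are immaterial; the state, in contrast,
  has to agree at every time.\<close>

lemma trajectory_on_spike:
  assumes tr: "trajectory_on f s T x0 u x"
    and N: "negligible N" "\<And>t. t \<in> {s..T} - N \<Longrightarrow> v t = u t"
    and y: "\<And>t. t \<in> {s..T} \<Longrightarrow> y t = x t"
  shows "trajectory_on f s T x0 v y"
  unfolding trajectory_on_def
proof (intro conjI ballI)
  have ai: "(\<lambda>\<tau>. f (x \<tau>, u \<tau>)) absolutely_integrable_on {s..T}"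
    and eq: "\<And>t. t \<in> {s..T} \<Longrightarrow> x t = x0 + integral {s..t} (\<lambda>\<tau>. f (x \<tau>, u \<tau>))"
    using tr by (auto simp: trajectory_on_def)
  show "(\<lambda>\<tau>. f (y \<tau>, v \<tau>)) absolutely_integrable_on {s..T}"
    by (rule absolutely_integrable_spike[OF ai N(1)]) (use N y in auto)
  fix t assume t: "t \<in> {s..T}"
  have "integral {s..t} (\<lambda>\<tau>. f (x \<tau>, u \<tau>)) = integral {s..t} (\<lambda>\<tau>. f (y \<tau>, v \<tau>))"
    by (rule integral_spike[OF N(1)]) (use N y t in auto)
  then show "y t = x0 + integral {s..t} (\<lambda>\<tau>. f (y \<tau>, v \<tau>))"
    using eq[OF t] y[OF t] by simp
qed

lemma trajectory_on_shift:
  assumes tr: "trajectory_on f s T x0 u x"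
  shows "trajectory_on f (s - c) (T - c) x0 (\<lambda>t. u (t + c)) (\<lambda>t. x (t + c))"
  unfolding trajectory_on_def
proof (intro conjI ballI)
  have ai: "(\<lambda>\<tau>. f (x \<tau>, u \<tau>)) absolutely_integrable_on {s..T}"
    and eq: "\<And>t. t \<in> {s..T} \<Longrightarrow> x t = x0 + integral {s..t} (\<lambda>\<tau>. f (x \<tau>, u \<tau>))"
    using tr by (auto simp: trajectory_on_def)
  show "(\<lambda>\<tau>. f (x (\<tau> + c), u (\<tau> + c))) absolutely_integrable_on {s - c..T - c}"
    using ai integrable_shift_real_ivl[of "\<lambda>\<tau>. f (x \<tau>, u \<tau>)" s T c]
      integrable_shift_real_ivl[of "\<lambda>\<tau>. norm (f (x \<tau>, u \<tau>))" s T c]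
    by (auto simp: absolutely_integrable_on_def)
  fix t assume t: "t \<in> {s - c..T - c}"
  then show "x (t + c) = x0 + integral {s - c..t} (\<lambda>\<tau>. f (x (\<tau> + c), u (\<tau> + c)))"
    using eq[of "t + c"] integral_shift_real_ivl[of s c "t + c" "\<lambda>\<tau>. f (x \<tau>, u \<tau>)"] by auto
qed

subsection \<open>Dependence on the initial state\<close>

text \<open>A Gronwall estimate by absorption: the distance is weighted by
  \<open>exp (- (2 * L * (t - s)))\<close> and inspected at the point \<open>p\<close> where the
  weighted distance \<open>g\<close> is largest. There the integral term takes up at most half of
  the left-hand side, which costs the factor 2. The Lipschitz bound is asked only along the two
  curves, so a constant valid on one ball suffices.\<close>

lemma trajectory_on_dist_le:
  fixes f :: "'a::euclidean_space \<times> 'b \<Rightarrow> 'a"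
  assumes x: "trajectory_on f s T x0 v x" and y: "trajectory_on f s T y0 v y"
    and L: "L > 0" "\<And>t. t \<in> {s..T} \<Longrightarrow> norm (f (x t, v t) - f (y t, v t)) \<le> L * norm (x t - y t)"
    and t: "t \<in> {s..T}"
  shows "norm (x t - y t) \<le> 2 * exp (2 * L * (t - s)) * norm (x0 - y0)"
proof -
  define g where "g r = exp (- (2 * L * (r - s))) * norm (x r - y r)" for r
  have gc: "continuous_on {s..T} g"
    unfolding g_def
    by (intro continuous_intros trajectory_on_continuous[OF x] trajectory_on_continuous[OF y])
  obtain p where p: "p \<in> {s..T}" "\<And>r. r \<in> {s..T} \<Longrightarrow> g r \<le> g p"
    using continuous_attains_sup[OF compact_Icc _ gc] t by (metis empty_iff)
  let ?e = "\<lambda>r. exp (2 * L * (r - s))"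
  have g_norm: "norm (x r - y r) = ?e r * g r" for r
    by (simp add: g_def exp_minus)
  let ?F = "\<lambda>\<tau>. f (x \<tau>, v \<tau>)" and ?G = "\<lambda>\<tau>. f (y \<tau>, v \<tau>)"
  have int: "?F integrable_on {s..p}" "?G integrable_on {s..p}"
    using trajectory_on_subinterval[OF x, of s p] trajectory_on_subinterval[OF y, of s p] p(1)
    unfolding trajectory_on_def by (auto intro: set_lebesgue_integral_eq_integral(1))
  \<comment> \<open>The weight grows at rate \<open>2 * L\<close>, so integrating \<open>L\<close>
    times the weight leaves half of it; this is the half that gets absorbed.\<close>
  have "((\<lambda>r. L * g p * ?e r) has_integral g p / 2 * ?e p - g p / 2 * ?e s) {s..p}"
    using p(1) by (intro fundamental_theorem_of_calculus)
      (auto intro!: derivative_eq_intros simp flip: has_real_derivative_iff_has_vector_derivative)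
  then have I: "((\<lambda>r. L * g p * ?e r) has_integral g p / 2 * (?e p - 1)) {s..p}"
    by (simp add: algebra_simps)
  have "norm (integral {s..p} (\<lambda>r. ?F r - ?G r)) \<le> integral {s..p} (\<lambda>r. L * g p * ?e r)"
  proof (rule integral_norm_bound_integral)
    show "(\<lambda>r. ?F r - ?G r) integrable_on {s..p}"
      using int by (rule integrable_diff)
    show "(\<lambda>r. L * g p * ?e r) integrable_on {s..p}"
      using I by (rule has_integral_integrable)
    fix r assume r: "r \<in> {s..p}"
    have "norm (?F r - ?G r) \<le> L * (?e r * g r)"
      using L(2)[of r] r p(1) by (simp add: g_norm)
    also have "\<dots> \<le> L * (?e r * g p)"
      using p r L(1) by (intro mult_left_mono) auto
    finally show "norm (?F r - ?G r) \<le> L * g p * ?e r"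
      by (simp add: mult_ac)
  qed
  then have "norm (integral {s..p} ?F - integral {s..p} ?G) \<le> g p / 2 * (?e p - 1)"
    unfolding integral_unique[OF I] Henstock_Kurzweil_Integration.integral_diff[OF int] .
  moreover have "x p - y p = (x0 - y0) + (integral {s..p} ?F - integral {s..p} ?G)"
    using x y p(1) by (simp add: trajectory_on_def algebra_simps)
  ultimately have "?e p * g p \<le> norm (x0 - y0) + g p / 2 * (?e p - 1)"
    unfolding g_norm[symmetric] by (smt (verit) norm_triangle_ineq)
  moreover have "1 \<le> ?e p" using p(1) L(1) by simp
  moreover have "0 \<le> g p" by (simp add: g_def)
  ultimately have "?e p * g p / 2 \<le> norm (x0 - y0)"
    by (simp add: algebra_simps)
  moreover have "1 * g p \<le> ?e p * g p"
    using \<open>1 \<le> ?e p\<close> \<open>0 \<le> g p\<close> by (rule mult_right_mono)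
  ultimately have "g t \<le> 2 * norm (x0 - y0)"
    using p(2)[OF t] by simp
  then have "?e t * g t \<le> ?e t * (2 * norm (x0 - y0))"
    by (rule mult_left_mono) simp
  then show ?thesis
    unfolding g_norm[symmetric] by (simp add: mult_ac)
qed

text \<open>This makes the Picard integrand meaningful: a continuous function of measurable ones is
  measurable, and a bounded measurable function on a compact interval is integrable.\<close>

lemma absolutely_integrable_along_continuous:
  fixes F :: "'a::euclidean_space \<times> 'b::euclidean_space \<Rightarrow> 'c::euclidean_space"
    and s T :: real
  assumes F: "continuous_on UNIV F" and z: "continuous_on {s..T} z"
    and v: "v \<in> borel_measurable borel" and C: "\<And>t. t \<in> {s..T} \<Longrightarrow> norm (F (z t, v t)) \<le> C"
  shows "(\<lambda>t. F (z t, v t)) absolutely_integrable_on {s..T}"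
proof (rule measurable_bounded_by_integrable_imp_absolutely_integrable)
  have zm: "z \<in> borel_measurable (lebesgue_on {s..T})"
    by (rule continuous_imp_measurable_on_sets_lebesgue[OF z]) simp
  have vm: "v \<in> borel_measurable (lebesgue_on {s..T})"
    using v by (simp add: measurable_completion measurable_restrict_space1)
  have "F \<in> borel_measurable borel"
    using F by (rule borel_measurable_continuous_onI)
  then show "(\<lambda>t. F (z t, v t)) \<in> borel_measurable (lebesgue_on {s..T})"
    by (rule measurable_compose[rotated]) (intro borel_measurable_Pair zm vm)
  show "(\<lambda>t. C) integrable_on {s..T}" by (rule integrable_const_ivl)
  show "{s..T} \<in> sets lebesgue" by simp
qed (rule C)

text \<open>With the weight \<open>exp (- 2 L t)\<close> the Picard operator is a contraction on the whole
  interval.\<close>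

lemma caratheodory_exists:
  fixes F :: "'a::euclidean_space \<times> 'b::euclidean_space \<Rightarrow> 'a"
  assumes F: "continuous_on UNIV F" and v: "v \<in> borel_measurable borel"
    and C: "\<And>\<xi> t. norm (F (\<xi>, v t)) \<le> C"
    and L: "L > 0" "\<And>\<xi> \<eta> t. norm (F (\<xi>, v t) - F (\<eta>, v t)) \<le> L * norm (\<xi> - \<eta>)"
    and T: "0 \<le> T"
  shows "\<exists>x. trajectory_on F 0 T y v x"
proof -
  \<comment> \<open>The Banach space consists of bounded continuous functions on the whole line, so
    time is clamped to \<open>{0..T}\<close> and images are extended by constants.\<close>
  define c where "c t = max 0 (min T t)" for t
  have c: "c t \<in> {0..T}" "t \<in> {0..T} \<Longrightarrow> c t = t" for t
    using T by (auto simp: c_def)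
  have cc: "continuous_on S c" for S
    unfolding c_def by (intro continuous_intros)
  let ?e = "\<lambda>r. exp (2 * L * r)"
  let ?I = "\<lambda>w :: real \<Rightarrow>\<^sub>C 'a. \<lambda>\<tau>. F (?e \<tau> *\<^sub>R w \<tau>, v \<tau>)"
  define P where "P w t = y + integral {0..t} (?I w)" for w :: "real \<Rightarrow>\<^sub>C 'a" and t
  \<comment> \<open>The unknown \<open>w\<close> is the trajectory times the weight, so the plain
    sup metric in \<open>w\<close> is the weighted one for trajectories. \<open>Q\<close> is the
    Picard operator \<open>P\<close> in this variable.\<close>
  define Q where "Q w t = exp (- (2 * L * c t)) *\<^sub>R P w (c t)" for w :: "real \<Rightarrow>\<^sub>C 'a" and t
  have ai: "?I w absolutely_integrable_on {0..T}" for w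
    by (rule absolutely_integrable_along_continuous[OF F _ v C]) (auto intro!: continuous_intros)
  have int: "?I w integrable_on {0..t}" if "t \<in> {0..T}" for w t
    using that ai by (intro set_lebesgue_integral_eq_integral(1) absolutely_integrable_on_subinterval[OF ai]) auto
  have Pc: "continuous_on {0..T} (P w)" for w
    unfolding P_def using int[of T] T by (intro continuous_intros indefinite_integral_continuous_1) auto
  have Qc: "continuous_on UNIV (Q w)" for w
    unfolding Q_def
    by (intro continuous_intros cc continuous_on_compose2[OF Pc cc]) (use c in auto)
  have "Q w \<in> bcontfun" for w
  proof -
    have "bounded (P w ` {0..T})"
      by (intro compact_imp_bounded compact_continuous_image Pc) auto
    then obtain K where K: "\<And>t. t \<in> {0..T} \<Longrightarrow> norm (P w t) \<le> K"
      unfolding bounded_iff by blast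
    have "norm (Q w t) \<le> 1 * K" for t
      unfolding Q_def norm_scaleR using c(1)[of t] L(1) K[OF c(1)[of t]]
      by (intro mult_mono) auto
    then show ?thesis
      by (intro bcontfun_normI[OF Qc])
  qed
  then have Q: "apply_bcontfun (Bcontfun (Q w)) = Q w" for w
    by (simp add: Bcontfun_inverse)
  have "\<exists>!w. Bcontfun (Q w) = w"
  proof (rule banach_fix_type)
    show "(0::real) \<le> 1 / 2" "1 / 2 < (1::real)" by auto
    show "\<forall>w w'. dist (Bcontfun (Q w)) (Bcontfun (Q w')) \<le> 1 / 2 * dist w w'"
    proof (intro allI dist_bound)
      fix w w' :: "real \<Rightarrow>\<^sub>C 'a" and t :: real
      let ?d = "dist w w'" and ?c = "c t"
      have c0: "0 \<le> ?c" using c(1)[of t] by auto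
      \<comment> \<open>A weight of rate \<open>2 * L\<close> against the Lipschitz constant
        \<open>L\<close> gives the contraction factor 1/2, whatever \<open>T\<close> is.\<close>
      have "((\<lambda>r. L * ?d * ?e r) has_integral ?d / 2 * ?e ?c - ?d / 2 * ?e 0) {0..?c}"
        using c0 by (intro fundamental_theorem_of_calculus)
          (auto intro!: derivative_eq_intros simp flip: has_real_derivative_iff_has_vector_derivative)
      then have I: "((\<lambda>r. L * ?d * ?e r) has_integral ?d / 2 * (?e ?c - 1)) {0..?c}"
        by (simp add: algebra_simps)
      have "norm (integral {0..?c} (\<lambda>r. ?I w r - ?I w' r)) \<le> integral {0..?c} (\<lambda>r. L * ?d * ?e r)"
      proof (rule integral_norm_bound_integral)
        show "(\<lambda>r. ?I w r - ?I w' r) integrable_on {0..?c}"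
          using int[OF c(1)] int[OF c(1)] by (rule integrable_diff)
        show "(\<lambda>r. L * ?d * ?e r) integrable_on {0..?c}"
          using I by (rule has_integral_integrable)
        fix r
        have "norm (?I w r - ?I w' r) \<le> L * norm (?e r *\<^sub>R w r - ?e r *\<^sub>R w' r)"
          by (rule L(2))
        also have "\<dots> = L * (?e r * dist (w r) (w' r))"
          by (simp add: dist_norm flip: scaleR_diff_right)
        also have "\<dots> \<le> L * (?e r * ?d)"
          using L(1) by (intro mult_left_mono dist_bounded) auto
        finally show "norm (?I w r - ?I w' r) \<le> L * ?d * ?e r"
          by (simp add: mult_ac)
      qed
      then have *: "norm (P w ?c - P w' ?c) \<le> ?d / 2 * (?e ?c - 1)"
        unfolding P_def integral_unique[OF I]
          Henstock_Kurzweil_Integration.integral_diff[OF int[OF c(1)] int[OF c(1)]] by simp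
      have "dist (Q w t) (Q w' t) = exp (- (2 * L * ?c)) * norm (P w ?c - P w' ?c)"
        unfolding Q_def by (simp add: dist_norm flip: scaleR_diff_right)
      also have "\<dots> \<le> exp (- (2 * L * ?c)) * (?d / 2 * ?e ?c)"
      proof (rule mult_left_mono)
        have "?d / 2 * (?e ?c - 1) \<le> ?d / 2 * ?e ?c"
          by (intro mult_left_mono) auto
        with * show "norm (P w ?c - P w' ?c) \<le> ?d / 2 * ?e ?c" by (rule order_trans)
      qed simp
      also have "\<dots> = 1 / 2 * ?d"
        by (simp add: exp_minus field_simps)
      finally show "dist (Bcontfun (Q w) t) (Bcontfun (Q w') t) \<le> 1 / 2 * ?d"
        unfolding Q .
    qed
  qed
  then obtain w where "Bcontfun (Q w) = w" by blast
  then have w: "Q w t = w t" for t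
    using Q by metis
  define x where "x t = ?e t *\<^sub>R w t" for t
  have xP: "x t = P w t" if "t \<in> {0..T}" for t
    using w[of t] c(2)[OF that] unfolding x_def Q_def
    by (metis exp_minus_inverse scaleR_one scaleR_scaleR)
  have "trajectory_on F 0 T y v x"
    unfolding trajectory_on_def x_def
    using ai xP by (auto simp: x_def P_def)
  then show ?thesis by blast
qed

text \<open>Compactness of the product of balls turns the local Lipschitz condition into one
  constant, uniform over bounded controls. The time parameter of \<open>local_lipschitz\<close> is a
  dummy, as \<open>f\<close> is autonomous.\<close>

lemma local_lipschitz_product_cballE:
  fixes f :: "'a::euclidean_space \<times> 'b::euclidean_space \<Rightarrow> 'a"
  assumes "local_lipschitz (UNIV :: real set) UNIV (\<lambda>_. f)"
  obtains L where "L > 0"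
    "\<And>\<xi> \<eta> w. norm \<xi> \<le> r \<Longrightarrow> norm \<eta> \<le> r \<Longrightarrow> norm w \<le> M \<Longrightarrow>
       norm (f (\<xi>, w) - f (\<eta>, w)) \<le> L * norm (\<xi> - \<eta>)"
proof -
  let ?X = "cball (0 :: 'a) r \<times> cball (0 :: 'b) M"
  have "compact ?X" by (intro compact_Times compact_cball)
  moreover have "local_lipschitz {0 :: real} ?X (\<lambda>_. f)"
    using assms by (rule local_lipschitz_subset) auto
  ultimately obtain L where L: "L-lipschitz_on ?X f"
    using local_lipschitz_compact_implies_lipschitz[of "{0 :: real}" ?X "\<lambda>_. f"]
    by (metis compact_sing continuous_on_const insertI1 local_lipschitz_compact_implies_lipschitz)
  show thesis
  proof
    show "max L 1 > 0" by simp
    fix \<xi> \<eta> :: 'a and w :: 'b assume "norm \<xi> \<le> r" "norm \<eta> \<le> r" "norm w \<le> M"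
    then have "dist (f (\<xi>, w)) (f (\<eta>, w)) \<le> L * dist (\<xi>, w) (\<eta>, w)"
      by (intro lipschitz_onD[OF L]) auto
    also have "\<dots> \<le> max L 1 * norm (\<xi> - \<eta>)"
      by (simp add: dist_Pair_Pair dist_norm mult_right_mono)
    finally show "norm (f (\<xi>, w) - f (\<eta>, w)) \<le> max L 1 * norm (\<xi> - \<eta>)"
      by (simp add: dist_norm)
  qed
qed

lemma trajectory_on_bounded:
  fixes x :: "real \<Rightarrow> 'a::euclidean_space"
  assumes "trajectory_on f s T x0 u x"
  obtains r where "r \<ge> 0" "\<And>t. t \<in> {s..T} \<Longrightarrow> norm (x t) \<le> r"
proof -
  have "bounded (x ` {s..T})"
    by (intro compact_imp_bounded compact_continuous_image trajectory_on_continuous[OF assms]) auto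
  then obtain r where "\<And>t. t \<in> {s..T} \<Longrightarrow> norm (x t) \<le> r"
    unfolding bounded_iff by blast
  then show thesis
    by (intro that[of "max r 0"]) (auto simp: le_max_iff_disj)
qed

text \<open>Both curves are continuous, hence stay in one ball on which \<open>f\<close> is
  Lipschitz in the state; the distance estimate with equal initial states gives zero. This later
  identifies closed-loop solutions with planned trajectories.\<close>

lemma trajectory_on_unique:
  fixes f :: "'a::euclidean_space \<times> 'b::euclidean_space \<Rightarrow> 'a"
  assumes f: "local_lipschitz (UNIV :: real set) UNIV (\<lambda>_. f)"
    and u: "admissible_control {s..T} u"
    and x: "trajectory_on f s T x0 u x" and y: "trajectory_on f s T x0 u y"
    and t: "t \<in> {s..T}"
  shows "x t = y t"
proof -
  obtain v M where v: "v \<in> borel_measurable borel" "\<And>t. norm (v t) \<le> M"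
    and N: "negligible {t\<in>{s..T}. u t \<noteq> v t}"
    using admissible_control_borelE[OF u] by blast
  have xv: "trajectory_on f s T x0 v x" and yv: "trajectory_on f s T x0 v y"
    by (rule trajectory_on_spike[OF x N] trajectory_on_spike[OF y N]; auto)+
  obtain r where r: "\<And>t. t \<in> {s..T} \<Longrightarrow> norm (x t) \<le> r"
    using trajectory_on_bounded[OF x] by blast
  obtain r' where r': "\<And>t. t \<in> {s..T} \<Longrightarrow> norm (y t) \<le> r'"
    using trajectory_on_bounded[OF y] by blast
  obtain L where L: "L > 0"
    "\<And>\<xi> \<eta> w. norm \<xi> \<le> max r r' \<Longrightarrow> norm \<eta> \<le> max r r' \<Longrightarrow> norm w \<le> M \<Longrightarrow>
       norm (f (\<xi>, w) - f (\<eta>, w)) \<le> L * norm (\<xi> - \<eta>)"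
    using local_lipschitz_product_cballE[OF f] by blast
  have "norm (x t - y t) \<le> 2 * exp (2 * L * (t - s)) * norm (x0 - x0)"
    by (rule trajectory_on_dist_le[OF xv yv L(1) _ t]) (auto intro!: L(2) v(2) simp: r r' le_max_iff_disj)
  then show ?thesis by simp
qed

lemma local_lipschitz_const_imp_continuous_on:
  fixes f :: "'a::metric_space \<Rightarrow> 'b::metric_space"
  assumes "local_lipschitz (UNIV :: real set) UNIV (\<lambda>_. f)"
  shows "continuous_on UNIV f"
  using local_lipschitz_continuous_on[OF assms] by simp

text \<open>The vector field is made globally Lipschitz by projecting the state to a large ball, which
  solutions starting near \<open>x0\<close> never leave.\<close>

lemma trajectory_on_perturb:
  fixes f :: "'a::euclidean_space \<times> 'b::euclidean_space \<Rightarrow> 'a"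
  assumes f: "local_lipschitz (UNIV :: real set) UNIV (\<lambda>_. f)"
    and u: "admissible_control {0..T} u"
    and x: "trajectory_on f 0 T x0 u x"
    and T: "0 \<le> T" and e: "e > 0"
  shows "\<exists>d>0. \<forall>y0. dist y0 x0 < d \<longrightarrow>
    (\<exists>y. trajectory_on f 0 T y0 u y \<and> (\<forall>t\<in>{0..T}. dist (y t) (x t) < e))"
proof -
  have fc: "continuous_on UNIV f"
    using f by (rule local_lipschitz_const_imp_continuous_on)
  obtain v M where v: "v \<in> borel_measurable borel" "\<And>t. norm (v t) \<le> M"
    and N: "negligible {t\<in>{0..T}. u t \<noteq> v t}"
    using admissible_control_borelE[OF u] by blast
  obtain r where r: "r \<ge> 0" "\<And>t. t \<in> {0..T} \<Longrightarrow> norm (x t) \<le> r"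
    using trajectory_on_bounded[OF x] by blast
  define B where "B = cball (0 :: 'a) (r + e)"
  have B: "convex B" "closed B" "B \<noteq> {}"
    using r(1) e by (auto simp: B_def)
  \<comment> \<open>The projection is nonexpansive, so \<open>F\<close> inherits on the whole space
    the Lipschitz constant that \<open>f\<close> has on the ball. The margin \<open>e\<close> in the
    radius leaves room for the perturbed solution.\<close>
  define p where "p = closest_point B"
  have pB: "p \<xi> \<in> B" for \<xi>
    unfolding p_def using B by (simp add: closest_point_in_set)
  have pid: "p \<xi> = \<xi>" if "norm \<xi> \<le> r + e" for \<xi>
    unfolding p_def using that by (simp add: closest_point_self B_def)
  have plip: "norm (p \<xi> - p \<eta>) \<le> norm (\<xi> - \<eta>)" for \<xi> \<eta>
    using closest_point_lipschitz[OF B] by (simp add: p_def dist_norm)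
  have pc: "continuous_on UNIV p"
    unfolding p_def by (rule continuous_on_closest_point[OF B])
  obtain L where L: "L > 0"
    "\<And>\<xi> \<eta> w. norm \<xi> \<le> r + e \<Longrightarrow> norm \<eta> \<le> r + e \<Longrightarrow> norm w \<le> M \<Longrightarrow>
       norm (f (\<xi>, w) - f (\<eta>, w)) \<le> L * norm (\<xi> - \<eta>)"
    using local_lipschitz_product_cballE[OF f] by blast
  define F where "F = (\<lambda>(\<xi>, w). f (p \<xi>, w))"
  have Fc: "continuous_on UNIV F"
    unfolding F_def case_prod_unfold
    by (intro continuous_on_compose2[OF fc] continuous_intros continuous_on_compose2[OF pc]) auto
  have Flip: "norm (F (\<xi>, v t) - F (\<eta>, v t)) \<le> L * norm (\<xi> - \<eta>)" for \<xi> \<eta> t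
  proof -
    have "norm (F (\<xi>, v t) - F (\<eta>, v t)) \<le> L * norm (p \<xi> - p \<eta>)"
      using L(2)[of "p \<xi>" "p \<eta>" "v t"] pB v(2) by (simp add: F_def B_def)
    also have "\<dots> \<le> L * norm (\<xi> - \<eta>)"
      using L(1) by (intro mult_left_mono plip) auto
    finally show ?thesis .
  qed
  have "bounded (f ` (B \<times> cball 0 M))"
    unfolding B_def
    by (intro compact_imp_bounded compact_continuous_image compact_Times compact_cball
        continuous_on_subset[OF fc]) auto
  then obtain C where C: "\<And>z. z \<in> B \<times> cball 0 M \<Longrightarrow> norm (f z) \<le> C"
    unfolding bounded_iff by blast
  have FC: "norm (F (\<xi>, v t)) \<le> C" for \<xi> t
    unfolding F_def using pB v(2) by (auto intro!: C)
  have xv: "trajectory_on f 0 T x0 v x"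
    by (rule trajectory_on_spike[OF x N]) auto
  have F_eq: "trajectory_on F 0 T y0 v y \<longleftrightarrow> trajectory_on f 0 T y0 v y"
    if y: "\<And>t. t \<in> {0..T} \<Longrightarrow> norm (y t) \<le> r + e" for y0 y
  proof -
    have eq: "F (y t, v t) = f (y t, v t)" if "t \<in> {0..T}" for t
      using pid[OF y[OF that]] by (simp add: F_def)
    have "(\<lambda>t. F (y t, v t)) absolutely_integrable_on {0..T} \<longleftrightarrow>
        (\<lambda>t. f (y t, v t)) absolutely_integrable_on {0..T}"
      by (intro set_integrable_cong refl eq)
    moreover have "integral {0..t} (\<lambda>t. F (y t, v t)) = integral {0..t} (\<lambda>t. f (y t, v t))"
      if "t \<in> {0..T}" for t
      using that by (intro integral_cong eq) auto
    ultimately show ?thesis by (simp add: trajectory_on_def)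
  qed
  have xF: "trajectory_on F 0 T x0 v x"
    using xv r(2) e by (subst F_eq) (auto intro: add_increasing2)
  \<comment> \<open>Chosen so that the factor \<open>2 * exp (2 * L * T)\<close> of the distance
    estimate turns \<open>d\<close> into \<open>e\<close>.\<close>
  define d where "d = e / (2 * exp (2 * L * T))"
  show ?thesis
  proof (intro exI[of _ d] conjI allI impI)
    show "d > 0" using e by (simp add: d_def)
    fix y0 assume y0: "dist y0 x0 < d"
    obtain y where yF: "trajectory_on F 0 T y0 v y"
      using caratheodory_exists[OF Fc v(1) FC L(1) Flip T] by blast
    have close: "dist (y t) (x t) < e" if t: "t \<in> {0..T}" for t
    proof -
      have "norm (y t - x t) \<le> 2 * exp (2 * L * (t - 0)) * norm (y0 - x0)"
        by (rule trajectory_on_dist_le[OF yF xF L(1) Flip t])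
      also have "\<dots> \<le> 2 * exp (2 * L * T) * norm (y0 - x0)"
        using t L(1) by (intro mult_right_mono) auto
      also have "\<dots> < 2 * exp (2 * L * T) * d"
        using y0 by (intro mult_strict_left_mono) (auto simp: dist_norm)
      finally show ?thesis by (simp add: d_def dist_norm)
    qed
    \<comment> \<open>Closeness to \<open>x\<close> was proved for the modified field; it keeps
      \<open>y\<close> in the ball, where the modified field equals \<open>f\<close>.\<close>
    have "norm (y t) \<le> r + e" if "t \<in> {0..T}" for t
      using close[OF that] r(2)[OF that] norm_triangle_ineq2[of "y t" "x t"] by (simp add: dist_norm)
    then have yv: "trajectory_on f 0 T y0 v y"
      using yF F_eq by blast
    have "trajectory_on f 0 T y0 u y"
      by (rule trajectory_on_spike[OF yv N]) auto
    then show "\<exists>y. trajectory_on f 0 T y0 u y \<and> (\<forall>t\<in>{0..T}. dist (y t) (x t) < e)"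
      using close by blast
  qed
qed

subsection \<open>Concatenation over a time partition\<close>

lemma time_partition_nonneg: "time_partition T \<Longrightarrow> 0 \<le> T i"
  unfolding time_partition_def by (metis le0 strict_mono_less_eq)

lemma time_partition_Suc: "time_partition T \<Longrightarrow> T i < T (Suc i)"
  unfolding time_partition_def by (simp add: strict_mono_less)

lemma time_partition_cover:
  assumes T: "time_partition T" and t: "0 \<le> t"
  obtains i where "T i \<le> t" "t < T (Suc i)"
proof -
  have "\<exists>n. t < T n"
    using T unfolding time_partition_def filterlim_at_top_dense
    by (metis eventually_sequentially order_refl)
  moreover have "\<not> t < T 0"
    using T t by (simp add: time_partition_def)
  ultimately obtain i where "\<not> t < T i" "t < T (Suc i)"
    using ex_least_nat_less[of "\<lambda>n. t < T n"] by (metis order_refl)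
  then show thesis by (intro that[of i]) auto
qed

text \<open>A breakpoint belongs to the piece on its right, in accordance with the half-open
  sampling intervals of the closed loop.\<close>

definition glue :: "(nat \<Rightarrow> real) \<Rightarrow> (nat \<Rightarrow> real \<Rightarrow> 'a) \<Rightarrow> real \<Rightarrow> 'a" where
  "glue T w t = w (LEAST i. t < T (Suc i)) t"

lemma glue_eq:
  assumes T: "time_partition T" and t: "T i \<le> t" "t < T (Suc i)"
  shows "glue T w t = w i t"
proof -
  have "(LEAST i. t < T (Suc i)) = i"
  proof (rule Least_equality)
    fix j assume j: "t < T (Suc j)"
    with t have "T i < T (Suc j)" by simp
    then show "i \<le> j" 
      using T by (simp add: time_partition_def strict_mono_less)
  qed (rule t)
  then show ?thesis by (simp add: glue_def)
qed

lemma glue_eq_closed: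
  assumes T: "time_partition T" and w: "\<And>i. w i (T (Suc i)) = w (Suc i) (T (Suc i))"
    and t: "t \<in> {T i..T (Suc i)}"
  shows "glue T w t = w i t"
proof (cases "t < T (Suc i)")
  case True
  then show ?thesis using glue_eq[OF T] t by auto
next
  case False
  then have "t = T (Suc i)" using t by auto
  then show ?thesis
    using glue_eq[OF T, of "Suc i" t w] time_partition_Suc[OF T, of "Suc i"] w by auto
qed

text \<open>Measurability comes from the pointwise limit of the truncations to
  \<open>{s..s + real n}\<close>; boundedness holds because a compact subset of the half line lies
  in one \<open>{s..b}\<close>.\<close>

lemma admissible_control_halfline:
  fixes u :: "real \<Rightarrow> 'b::euclidean_space"
  assumes u: "\<And>b. b \<ge> s \<Longrightarrow> admissible_control {s..b} u"
  shows "admissible_control {s..} u"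
  unfolding admissible_control_def
proof (intro conjI allI impI)
  have "(\<lambda>t. if t \<in> {s..} then u t else 0) \<in> borel_measurable lebesgue"
  proof (rule borel_measurable_LIMSEQ_metric)
    fix n :: nat
    have "u \<in> borel_measurable (lebesgue_on {s..s + real n})"
      using u[of "s + real n"] by (simp add: admissible_control_def)
    then show "(\<lambda>t. if t \<in> {s..s + real n} then u t else 0) \<in> borel_measurable lebesgue"
      by (subst borel_measurable_if) auto
  next
    fix t
    obtain n :: nat where n: "t - s < real n" using reals_Archimedean2 by blast
    have "\<forall>\<^sub>F k in sequentially. (if t \<in> {s..s + real k} then u t else 0) = (if t \<in> {s..} then u t else 0)"
      using eventually_ge_at_top[of n] by eventually_elim (use n in auto)
    then show "(\<lambda>k. if t \<in> {s..s + real k} then u t else 0) \<longlonglongrightarrow> (if t \<in> {s..} then u t else 0)"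
      by (rule tendsto_eventually)
  qed
  then show "u \<in> borel_measurable (lebesgue_on {s..})"
    by (subst (asm) borel_measurable_if) auto
next
  fix C :: "real set" assume C: "compact C \<and> C \<subseteq> {s..}"
  then have "bounded C" by (simp add: compact_imp_bounded)
  then obtain b where b: "\<And>t. t \<in> C \<Longrightarrow> norm t \<le> b"
    unfolding bounded_iff by blast
  have "C \<subseteq> {s..max s b}"
  proof
    fix t assume "t \<in> C"
    then show "t \<in> {s..max s b}" using C b[of t] by auto
  qed
  then show "\<exists>M. AE t in lebesgue_on C. norm (u t) \<le> M"
    using C u[of "max s b"] by (auto simp: admissible_control_def)
qed

lemma admissible_control_glue:
  fixes u :: "nat \<Rightarrow> real \<Rightarrow> 'b::euclidean_space"
  assumes T: "time_partition T" and u: "\<And>i. admissible_control {T i..T (Suc i)} (u i)"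
  shows "admissible_control {0..} (glue T u)"
proof (rule admissible_control_halfline)
  fix b :: real assume b: "0 \<le> b"
  have n: "admissible_control {0..T n} (glue T u)" if "n > 0" for n
    using that
  proof (induction n rule: nat_induct_non_zero)
    case 1
    have T0: "T 0 = 0" using T by (simp add: time_partition_def)
    have "admissible_control {0..T 1} (u 0)" using u[of 0] T0 by simp
    \<comment> \<open>At \<open>T 1\<close> the glued control already has the value of the next
      piece; a single point is a null set.\<close>
    then show ?case
      by (rule admissible_control_spike[where N = "{T 1}"]) (auto simp: glue_eq[OF T, of 0] T0)
  next
    case (Suc n)
    show ?case
    proof (rule admissible_control_join)
      show "admissible_control {T n..T (Suc n)} (glue T u)"
        by (rule admissible_control_spike[OF u, where N = "{T (Suc n)}"])
          (auto simp: glue_eq[OF T, of n])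
    qed (rule Suc.IH)
  qed
  obtain i where i: "T i \<le> b" "b < T (Suc i)" using time_partition_cover[OF T b] .
  show "admissible_control {0..b} (glue T u)"
    by (rule admissible_control_subinterval[OF n[of "Suc i"]]) (use i in auto)
qed

text \<open>States have to match at breakpoints because each integral equation holds up to both
  ends; controls may jump there. The equation is kept interval by interval, as the closed-loop
  definition demands.\<close>

lemma trajectory_on_glue_step:
  fixes f :: "'a::euclidean_space \<times> 'b::euclidean_space \<Rightarrow> 'a"
  assumes T: "time_partition T"
    and tr: "\<And>i. trajectory_on f (T i) (T (Suc i)) (w i (T i)) (u i) (w i)"
    and w: "\<And>i. w i (T (Suc i)) = w (Suc i) (T (Suc i))"
  shows "trajectory_on f (T i) (T (Suc i)) (glue T w (T i)) (glue T u) (glue T w)"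
proof -
  have "glue T w (T i) = w i (T i)"
    using glue_eq[OF T order_refl time_partition_Suc[OF T]] .
  moreover have "trajectory_on f (T i) (T (Suc i)) (w i (T i)) (glue T u) (glue T w)"
    by (rule trajectory_on_spike[OF tr, where N = "{T (Suc i)}"])
      (auto simp: glue_eq[OF T, of i] glue_eq_closed[of T w, OF T w])
  ultimately show ?thesis by simp
qed

lemma trajectory_on_glue:
  fixes f :: "'a::euclidean_space \<times> 'b::euclidean_space \<Rightarrow> 'a"
  assumes T: "time_partition T"
    and tr: "\<And>i. trajectory_on f (T i) (T (Suc i)) (w i (T i)) (u i) (w i)"
    and w: "\<And>i. w i (T (Suc i)) = w (Suc i) (T (Suc i))"
    and b: "b \<ge> 0"
  shows "trajectory_on f 0 b (w 0 0) (glue T u) (glue T w)"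
proof -
  have T0: "T 0 = 0" using T by (simp add: time_partition_def)
  have w0: "glue T w 0 = w 0 0"
    using glue_eq[OF T, of 0 0] T0 time_partition_Suc[OF T, of 0] by simp
  have step: "trajectory_on f (T i) (T (Suc i)) (glue T w (T i)) (glue T u) (glue T w)" for i
    using T tr w by (rule trajectory_on_glue_step)
  have n: "trajectory_on f 0 (T n) (w 0 0) (glue T u) (glue T w)" if "n > 0" for n
    using that
  proof (induction n rule: nat_induct_non_zero)
    case 1
    show ?case using step[of 0] T0 w0 by simp
  next
    case (Suc n)
    then show ?case
      using trajectory_on_join[OF _ step[of n]] time_partition_nonneg[OF T] time_partition_Suc[OF T]
      by (simp add: less_imp_le)
  qed
  obtain i where "T i \<le> b" "b < T (Suc i)" using time_partition_cover[OF T b] .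
  then show ?thesis
    using trajectory_on_subinterval[OF n[of "Suc i"], of 0 b] w0 by simp
qed

subsection \<open>Steering along sublevel sets\<close>

text \<open>Control and trajectory are hidden so that manoeuvres compose as a relation; all of them
  can start at time 0 because the system is autonomous.\<close>

definition steers :: "('a::euclidean_space \<times> 'b::euclidean_space \<Rightarrow> 'a) \<Rightarrow> ('a \<Rightarrow> real) \<Rightarrow> real \<Rightarrow> real \<Rightarrow> 'a \<Rightarrow> 'a \<Rightarrow> bool" where
  "steers f V B \<tau> y z \<longleftrightarrow>
     (\<exists>u x. admissible_control {0..\<tau>} u \<and> trajectory_on f 0 \<tau> y u x \<and> x \<tau> = z \<and> (\<forall>s\<in>{0..\<tau>}. V (x s) \<le> B))"

lemma admissible_control_const: "admissible_control {s..T} (\<lambda>_. c :: 'b::euclidean_space)"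
  by (rule borel_admissible_control[where v = "\<lambda>_. c" and M = "norm c"]) auto

lemma steers_refl: "V y \<le> B \<Longrightarrow> steers f V B 0 y y"
  unfolding steers_def
  by (intro exI[of _ "\<lambda>_. 0"] exI[of _ "\<lambda>_. y"])
    (auto simp: trajectory_on_def admissible_control_const[of 0 0, simplified]
      intro: absolutely_integrable_on_null[of 0 0, simplified])

lemma steers_mono: "steers f V B \<tau> y z \<Longrightarrow> B \<le> B' \<Longrightarrow> steers f V B' \<tau> y z"
  unfolding steers_def by (blast intro: order_trans)

lemma steers_trans:
  assumes s1: "steers f V B \<tau>1 y z" and s2: "steers f V B \<tau>2 z w" and \<tau>: "0 \<le> \<tau>1" "0 \<le> \<tau>2"
  shows "steers f V B (\<tau>1 + \<tau>2) y w"
proof -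
  obtain u1 x1 where 1: "admissible_control {0..\<tau>1} u1" "trajectory_on f 0 \<tau>1 y u1 x1" "x1 \<tau>1 = z"
    "\<And>s. s \<in> {0..\<tau>1} \<Longrightarrow> V (x1 s) \<le> B"
    using s1 unfolding steers_def by blast
  obtain u2 x2 where 2: "admissible_control {0..\<tau>2} u2" "trajectory_on f 0 \<tau>2 z u2 x2" "x2 \<tau>2 = w"
    "\<And>s. s \<in> {0..\<tau>2} \<Longrightarrow> V (x2 s) \<le> B"
    using s2 unfolding steers_def by blast
  define u where "u t = (if t < \<tau>1 then u1 t else u2 (t - \<tau>1))" for t
  define x where "x t = (if t \<le> \<tau>1 then x1 t else x2 (t - \<tau>1))" for t
  have x20: "x2 0 = z" using trajectory_on_initial[OF 2(2) \<tau>(2)] .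
  have x2: "x t = x2 (t - \<tau>1)" if "t \<ge> \<tau>1" for t
    using that x20 1(3) by (cases "t = \<tau>1") (auto simp: x_def)
  have a1: "admissible_control {0..\<tau>1} u"
    by (rule admissible_control_spike[OF 1(1), of "{\<tau>1}"]) (auto simp: u_def)
  have "admissible_control {\<tau>1..\<tau>1 + \<tau>2} (\<lambda>t. u2 (t - \<tau>1))"
    using admissible_control_shift[OF 2(1), of "- \<tau>1"] by (simp add: add.commute)
  then have a2: "admissible_control {\<tau>1..\<tau>1 + \<tau>2} u"
    by (rule admissible_control_spike[of _ _ _ "{}"]) (auto simp: u_def)
  have t1: "trajectory_on f 0 \<tau>1 y u x"
    by (rule trajectory_on_spike[OF 1(2), of "{\<tau>1}"]) (auto simp: u_def x_def)
  have "trajectory_on f \<tau>1 (\<tau>1 + \<tau>2) z (\<lambda>t. u2 (t - \<tau>1)) (\<lambda>t. x2 (t - \<tau>1))"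
    using trajectory_on_shift[OF 2(2), of "- \<tau>1"] by (simp add: add.commute)
  then have "trajectory_on f \<tau>1 (\<tau>1 + \<tau>2) z u x"
    by (rule trajectory_on_spike[where N = "{}"]) (auto simp: u_def x2)
  then have t2: "trajectory_on f \<tau>1 (\<tau>1 + \<tau>2) (x \<tau>1) u x"
    using 1(3) by (simp add: x_def)
  have "admissible_control {0..\<tau>1 + \<tau>2} u"
    using a1 a2 by (rule admissible_control_join)
  moreover have "trajectory_on f 0 (\<tau>1 + \<tau>2) y u x"
    using \<tau> by (intro trajectory_on_join[OF t1 t2]) auto
  moreover have "x (\<tau>1 + \<tau>2) = w"
    using 2(3) \<tau> by (simp add: x2)
  moreover have "V (x s) \<le> B" if "s \<in> {0..\<tau>1 + \<tau>2}" for s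
    using that 1(4)[of s] 2(4)[of "s - \<tau>1"] by (cases "s \<le> \<tau>1") (auto simp: x_def)
  ultimately show ?thesis
    unfolding steers_def by blast
qed

text \<open>The same control is run from the neighbouring state. The trajectories stay uniformly
  close, and \<open>V\<close> is uniformly continuous on a ball containing both, so overshoot and
  final value each deteriorate by at most \<open>e\<close>.\<close>

lemma steers_perturb:
  fixes f :: "'a::euclidean_space \<times> 'b::euclidean_space \<Rightarrow> 'a"
  assumes f: "local_lipschitz (UNIV :: real set) UNIV (\<lambda>_. f)" and V: "continuous_on UNIV V"
    and s: "steers f V B \<tau> y0 z0" and \<tau>: "0 \<le> \<tau>" and e: "e > 0"
  shows "\<exists>d>0. \<forall>y. dist y y0 < d \<longrightarrow> (\<exists>z. steers f V (B + e) \<tau> y z \<and> V z < V z0 + e)"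
proof -
  obtain u x where u: "admissible_control {0..\<tau>} u" and x: "trajectory_on f 0 \<tau> y0 u x"
    and z0: "x \<tau> = z0" and B: "\<And>s. s \<in> {0..\<tau>} \<Longrightarrow> V (x s) \<le> B"
    using s unfolding steers_def by blast
  obtain r where r: "\<And>t. t \<in> {0..\<tau>} \<Longrightarrow> norm (x t) \<le> r"
    using trajectory_on_bounded[OF x] by blast
  have "uniformly_continuous_on (cball 0 (r + 1)) V"
    by (intro compact_uniformly_continuous continuous_on_subset[OF V]) auto
  then obtain h where h: "h > 0"
    "\<And>p q. p \<in> cball 0 (r + 1) \<Longrightarrow> q \<in> cball 0 (r + 1) \<Longrightarrow> dist q p < h \<Longrightarrow> dist (V q) (V p) < e"
    unfolding uniformly_continuous_on_def using e by metis
  \<comment> \<open>Distance below 1 keeps the perturbed trajectory in the ball of radius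
    \<open>r + 1\<close>; distance below \<open>h\<close> makes the values of \<open>V\<close>
    close.\<close>
  obtain d where d: "d > 0" "\<And>y. dist y y0 < d \<Longrightarrow>
      \<exists>w. trajectory_on f 0 \<tau> y u w \<and> (\<forall>t\<in>{0..\<tau>}. dist (w t) (x t) < min h 1)"
    using trajectory_on_perturb[OF f u x \<tau>, of "min h 1"] h(1) by auto
  have "\<exists>z. steers f V (B + e) \<tau> y z \<and> V z < V z0 + e" if y: "dist y y0 < d" for y
  proof -
    obtain w where w: "trajectory_on f 0 \<tau> y u w"
      and close: "\<And>t. t \<in> {0..\<tau>} \<Longrightarrow> dist (w t) (x t) < min h 1"
      using d(2)[OF y] by blast
    have V_close: "V (w t) < V (x t) + e" if t: "t \<in> {0..\<tau>}" for t
    proof -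
      have "norm (w t) \<le> r + 1"
        using close[OF t] r[OF t] norm_triangle_ineq2[of "w t" "x t"] by (simp add: dist_norm)
      then have "dist (V (w t)) (V (x t)) < e"
        using close[OF t] r[OF t] by (intro h(2)) auto
      then show ?thesis by (simp add: dist_real_def)
    qed
    have "V (w t) \<le> B + e" if "t \<in> {0..\<tau>}" for t
      using V_close[OF that] B[OF that] by simp
    then have "steers f V (B + e) \<tau> y (w \<tau>)"
      unfolding steers_def using u w by blast
    moreover have "V (w \<tau>) < V z0 + e"
      using V_close[of \<tau>] \<tau> z0 by simp
    ultimately show ?thesis by blast
  qed
  then show ?thesis using d(1) by blast
qed

section \<open>Consequences of the decrease hypothesis\<close>

locale stabilizable =
  fixes f :: "'a::euclidean_space \<times> 'b::euclidean_space \<Rightarrow> 'a"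
    and V :: "'a \<Rightarrow> real"
    and a :: "real \<Rightarrow> real"
  assumes f_lipschitz: "local_lipschitz (UNIV :: real set) UNIV (\<lambda>_. f)"
    and f_zero: "f (0, 0) = 0"
    and V_continuous: "continuous_on UNIV V"
    and V_posdef: "positive_definite V"
    and V_proper: "proper_function V"
    and a_class_K: "class_K a"
    and decrease: "\<And>\<xi> x0. \<xi> > 0 \<Longrightarrow> x0 \<noteq> 0 \<Longrightarrow>
           \<exists>\<epsilon> u x. 0 < \<epsilon> \<and> \<epsilon> \<le> \<xi> \<and> admissible_control {0..\<epsilon>} u \<and>
             trajectory_on f 0 \<epsilon> x0 u x \<and>
             V (x \<epsilon>) < V x0 \<and> (\<forall>s\<in>{0..\<epsilon>}. V (x s) \<le> a (V x0))"
begin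

lemma V_zero: "V 0 = 0" and V_pos: "x \<noteq> 0 \<Longrightarrow> V x > 0"
  using V_posdef unfolding positive_definite_def by simp_all

lemma a_zero: "a 0 = 0" and a_continuous: "continuous_on {0..} a"
  using a_class_K by (simp_all add: class_K_def)

lemma a_mono: "0 \<le> r \<Longrightarrow> r \<le> s \<Longrightarrow> a r \<le> a s"
  using a_class_K by (auto simp: class_K_def strict_mono_on_leD)

lemma a_nonneg: "0 \<le> r \<Longrightarrow> 0 \<le> a r"
  using a_mono[of 0 r] a_zero by simp

text \<open>On the part of the compact set \<open>{y. V y \<le> 1}\<close> outside the ball,
  \<open>V\<close> attains a positive minimum, unless that part is empty. Levels below both 1 and
  this minimum confine the state to the ball.\<close>

lemma V_small_imp_norm_small:
  assumes e: "e > 0"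
  shows "\<exists>r>0. \<forall>y. V y \<le> r \<longrightarrow> norm y < e"
proof -
  define Q where "Q = {y. V y \<le> 1} - ball 0 e"
  have "compact Q"
    unfolding Q_def using V_proper by (auto simp: proper_function_def intro: compact_diff)
  show ?thesis
  proof (cases "Q = {}")
    case True
    then have "\<forall>y. V y \<le> 1 \<longrightarrow> norm y < e" by (auto simp: Q_def)
    then show ?thesis using zero_less_one by blast
  next
    case False
    obtain p where p: "p \<in> Q" "\<And>y. y \<in> Q \<Longrightarrow> V p \<le> V y"
      using continuous_attains_inf[OF \<open>compact Q\<close> False continuous_on_subset[OF V_continuous]] by blast
    have pV: "V p > 0" using p(1) e by (intro V_pos) (auto simp: Q_def)
    have "norm y < e" if "V y \<le> min 1 (V p / 2)" for y
      using p(2)[of y] that pV by (force simp: Q_def)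
    then show ?thesis using pV by (intro exI[of _ "min 1 (V p / 2)"]) auto
  qed
qed

lemma uniform_decrease:
  assumes r: "0 < r"
  shows "\<exists>d>0. \<forall>y. r \<le> V y \<and> V y \<le> c \<longrightarrow>
    (\<exists>\<tau> z. 0 < \<tau> \<and> \<tau> \<le> 1 \<and> steers f V (a c + c) \<tau> y z \<and> V z \<le> V y - d)"
proof -
  define Q where "Q = {y. r \<le> V y \<and> V y \<le> c}"
  have Q_eq: "Q = {y. V y \<le> c} \<inter> {y. r \<le> V y}" by (auto simp: Q_def)
  have "compact Q"
    unfolding Q_eq using V_proper V_continuous
    by (intro compact_Int_closed closed_Collect_le) (auto simp: proper_function_def)
  have "\<exists>\<rho> d. \<rho> > 0 \<and> d > 0 \<and> (\<forall>y\<in>ball q \<rho>.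
      \<exists>\<tau> z. 0 < \<tau> \<and> \<tau> \<le> 1 \<and> steers f V (a c + c) \<tau> y z \<and> V z \<le> V y - d)" if q: "q \<in> Q" for q
  proof -
    have qr: "r \<le> V q" "V q \<le> c" using q by (auto simp: Q_def)
    then have "q \<noteq> 0" using V_zero r by auto
    \<comment> \<open>The horizon \<open>\<xi> = 1\<close> bounds every duration by 1, which later
      turns a number of steps into a bound on time.\<close>
    then obtain \<tau> u x where \<tau>: "0 < \<tau>" "\<tau> \<le> 1" and u: "admissible_control {0..\<tau>} u"
      and x: "trajectory_on f 0 \<tau> q u x" and dec: "V (x \<tau>) < V q"
      and bd: "\<forall>s\<in>{0..\<tau>}. V (x s) \<le> a (V q)"
      using decrease[of 1 q] by auto
    have "steers f V (a (V q)) \<tau> q (x \<tau>)"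
      unfolding steers_def using u x bd by blast
    then have st: "steers f V (a c) \<tau> q (x \<tau>)"
      using qr r by (elim steers_mono) (auto intro: a_mono)
    \<comment> \<open>The gap is split into thirds: one is lost in the perturbed end value, one in
      the variation of \<open>V\<close> near \<open>q\<close>, and one remains as decrease. The
      minimum with \<open>c\<close> keeps the overshoot below \<open>a c + c\<close>.\<close>
    define e where "e = min c ((V q - V (x \<tau>)) / 3)"
    have "e \<le> (V q - V (x \<tau>)) / 3" unfolding e_def by (rule min.cobounded2)
    then have e3: "3 * e \<le> V q - V (x \<tau>)" by simp
    have e: "e > 0" "e \<le> c" using dec qr r by (auto simp: e_def)
    obtain d1 where d1: "d1 > 0" "\<And>y. dist y q < d1 \<Longrightarrow> \<exists>z. steers f V (a c + e) \<tau> y z \<and> V z < V (x \<tau>) + e"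
      using steers_perturb[OF f_lipschitz V_continuous st _ e(1)] \<tau> by force
    obtain d2 where d2: "d2 > 0" "\<And>y. dist y q < d2 \<Longrightarrow> dist (V y) (V q) < e"
      using V_continuous e(1) unfolding continuous_on_iff by (metis UNIV_I)
    have "\<exists>\<tau> z. 0 < \<tau> \<and> \<tau> \<le> 1 \<and> steers f V (a c + c) \<tau> y z \<and> V z \<le> V y - e"
      if y: "y \<in> ball q (min d1 d2)" for y
    proof -
      have y1: "dist y q < d1" "dist (V y) (V q) < e"
        using y by (auto simp: dist_commute[of q y] intro: d2(2))
      then obtain z where z: "steers f V (a c + e) \<tau> y z" "V z < V (x \<tau>) + e"
        using d1(2) by blast
      have "steers f V (a c + c) \<tau> y z"
        using z(1) e(2) by (elim steers_mono) auto
      moreover have "V z \<le> V y - e"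
        using z(2) y1(2) e3 by (auto simp: dist_real_def)
      ultimately show ?thesis using \<tau> by blast
    qed
    then show ?thesis using d1(1) d2(1) e(1) by (metis min_less_iff_conj)
  qed
  then obtain \<rho> d where \<rho>: "\<And>q. q \<in> Q \<Longrightarrow> \<rho> q > 0" and d: "\<And>q. q \<in> Q \<Longrightarrow> d q > (0::real)"
    and st: "\<And>q y. q \<in> Q \<Longrightarrow> y \<in> ball q (\<rho> q) \<Longrightarrow>
      \<exists>\<tau> z. 0 < \<tau> \<and> \<tau> \<le> 1 \<and> steers f V (a c + c) \<tau> y z \<and> V z \<le> V y - d q"
    by metis
  have "Q \<subseteq> (\<Union>q\<in>Q. ball q (\<rho> q))"
    using \<rho> by (meson UN_I centre_in_ball subsetI)
  then obtain D where D: "D \<subseteq> Q" "finite D" "Q \<subseteq> (\<Union>q\<in>D. ball q (\<rho> q))"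
    using compactE_image[OF \<open>compact Q\<close>, of Q "\<lambda>q. ball q (\<rho> q)"] by auto
  \<comment> \<open>The element 1 keeps the minimum defined when \<open>D\<close> is empty.\<close>
  define m where "m = Min (insert 1 (d ` D))"
  have m: "m > 0" "\<And>q. q \<in> D \<Longrightarrow> m \<le> d q"
    using D(1,2) d by (auto simp: m_def)
  have "\<exists>\<tau> z. 0 < \<tau> \<and> \<tau> \<le> 1 \<and> steers f V (a c + c) \<tau> y z \<and> V z \<le> V y - m" if "r \<le> V y" "V y \<le> c" for y
  proof -
    have "y \<in> Q" using that by (simp add: Q_def)
    then obtain q where q: "q \<in> D" "y \<in> ball q (\<rho> q)" using D(3) by blast
    then obtain \<tau> z where "0 < \<tau>" "\<tau> \<le> 1" "steers f V (a c + c) \<tau> y z" "V z \<le> V y - d q"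
      using st D(1) by blast
    moreover from this m(2)[OF q(1)] have "V z \<le> V y - m" by simp
    ultimately show ?thesis by blast
  qed
  then show ?thesis using m(1) by blast
qed

text \<open>Each step gains at least \<open>d\<close> within one unit of time, so a number of steps
  of order \<open>c / d\<close> suffices and also bounds the time. Every step starts with
  \<open>V\<close> at most \<open>c\<close>, so the same overshoot bound serves all of them.\<close>

lemma reach_level:
  assumes r: "0 < r" "r \<le> c"
  shows "\<exists>N. \<forall>y. V y \<le> c \<longrightarrow> (\<exists>\<tau> z. 0 \<le> \<tau> \<and> \<tau> \<le> N \<and> steers f V (a c + c) \<tau> y z \<and> V z \<le> r)"
proof -
  obtain d where d: "d > 0" "\<And>y. r \<le> V y \<Longrightarrow> V y \<le> c \<Longrightarrow>
      \<exists>\<tau> z. 0 < \<tau> \<and> \<tau> \<le> 1 \<and> steers f V (a c + c) \<tau> y z \<and> V z \<le> V y - d"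
    using uniform_decrease[OF r(1)] by metis
  have step: "\<exists>\<tau> z. 0 \<le> \<tau> \<and> \<tau> \<le> real n \<and> steers f V (a c + c) \<tau> y z \<and> V z \<le> r"
    if "V y \<le> c" "V y \<le> r + real n * d" for n y
    using that
  proof (induction n arbitrary: y)
    case 0
    then have "steers f V (a c + c) 0 y y"
      using a_nonneg[of c] r by (intro steers_refl) auto
    then show ?case using 0 by auto
  next
    case (Suc n)
    show ?case
    proof (cases "r \<le> V y")
      case True
      then obtain \<tau> z where z: "0 < \<tau>" "\<tau> \<le> 1" "steers f V (a c + c) \<tau> y z" "V z \<le> V y - d"
        using d(2) Suc.prems(1) by blast
      have "V z \<le> c" "V z \<le> r + real n * d"
        using z(4) d(1) Suc.prems by (auto simp: algebra_simps)
      then obtain \<tau>' z' where z': "0 \<le> \<tau>'" "\<tau>' \<le> real n" "steers f V (a c + c) \<tau>' z z'" "V z' \<le> r"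
        using Suc.IH by blast
      have "steers f V (a c + c) (\<tau> + \<tau>') y z'"
        using z(1,3) z'(1,3) by (intro steers_trans) auto
      then show ?thesis
        using z(1,2) z' by (intro exI[of _ "\<tau> + \<tau>'"] exI[of _ z']) auto
    next
      case False
      have "steers f V (a c + c) 0 y y"
        using Suc.prems(1) a_nonneg[of c] r by (intro steers_refl) auto
      then show ?thesis using False by (intro exI[of _ 0] exI[of _ y]) auto
    qed
  qed
  obtain n :: nat where "c / d < real n" using reals_Archimedean2 by blast
  then have "c \<le> r + real n * d"
    using d(1) r by (simp add: field_simps)
  then show ?thesis
    using step[where n = n] by (metis order_trans)
qed

text \<open>The target level is entered via a much smaller one, from which the zero control keeps the
  state below the target for one unit of time; so a step never takes less than that.\<close>

lemma reach_level_slowly: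
  assumes c': "0 < c'" "c' \<le> c"
  shows "\<exists>N. \<forall>y. V y \<le> c \<longrightarrow> (\<exists>\<tau> z. 1 \<le> \<tau> \<and> \<tau> \<le> N \<and> steers f V (a c + c) \<tau> y z \<and> V z \<le> c')"
proof -
  have "trajectory_on f 0 1 0 (\<lambda>_. 0) (\<lambda>_. 0)"
    by (simp add: trajectory_on_def f_zero)
  then have "steers f V 0 1 0 0"
    unfolding steers_def by (intro exI[of _ "\<lambda>_. 0"]) (auto simp: V_zero admissible_control_const)
  then obtain \<delta> where \<delta>: "\<delta> > 0" "\<And>y. dist y 0 < \<delta> \<Longrightarrow> \<exists>z. steers f V (0 + c') 1 y z \<and> V z < V 0 + c'"
    using steers_perturb[OF f_lipschitz V_continuous, of 0 1 0 0 c'] c'(1) by auto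
  obtain r where r: "r > 0" "\<And>y. V y \<le> r \<Longrightarrow> norm y < \<delta>"
    using V_small_imp_norm_small[OF \<delta>(1)] by blast
  have "0 < min r c" "min r c \<le> c" using r(1) c' by auto
  then obtain N where N: "\<And>y. V y \<le> c \<Longrightarrow>
      \<exists>\<tau> z. 0 \<le> \<tau> \<and> \<tau> \<le> N \<and> steers f V (a c + c) \<tau> y z \<and> V z \<le> min r c"
    using reach_level by metis
  have "\<exists>\<tau> z. 1 \<le> \<tau> \<and> \<tau> \<le> N + 1 \<and> steers f V (a c + c) \<tau> y z \<and> V z \<le> c'" if y: "V y \<le> c" for y
  proof -
    obtain \<tau> z where z: "0 \<le> \<tau>" "\<tau> \<le> N" "steers f V (a c + c) \<tau> y z" "V z \<le> min r c"
      using N[OF y] by blast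
    then obtain w where w: "steers f V c' 1 z w" "V w < c'"
      using r(2)[of z] \<delta>(2)[of z] V_zero by auto
    have "steers f V (a c + c) 1 z w"
      using w(1) c' a_nonneg[of c] by (elim steers_mono) auto
    with z have "steers f V (a c + c) (\<tau> + 1) y w"
      by (intro steers_trans) auto
    then show ?thesis
      using z(1,2) w(2) by (intro exI[of _ "\<tau> + 1"] exI[of _ w]) auto
  qed
  then show ?thesis by blast
qed

end

subsection \<open>Plans\<close>

text \<open>A plan is an open-loop control on a half line together with its trajectory. Level \<open>k\<close> bounds
  \<open>V\<close> uniformly by \<open>M k\<close>; the deadlines \<open>S\<close> are in absolute time, so that switching between plans
  cannot postpone the decay.\<close>

definition (in stabilizable) plan ::
  "(nat \<Rightarrow> real) \<Rightarrow> (nat \<Rightarrow> real) \<Rightarrow> nat \<Rightarrow> real \<Rightarrow> 'a \<Rightarrow> (real \<Rightarrow> 'b) \<Rightarrow> (real \<Rightarrow> 'a) \<Rightarrow> bool" where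
  "plan M S k s y u x \<longleftrightarrow>
     admissible_control {s..} u \<and> (\<forall>b\<ge>s. trajectory_on f s b y u x) \<and>
     (\<forall>t\<ge>s. V (x t) \<le> M k \<and> (\<forall>j. S j \<le> t \<longrightarrow> V (x t) \<le> M j))"

context stabilizable
begin

text \<open>The durations depend on the states met, so the conclusion mentions only their bounds
  \<open>N\<close>: the piece \<open>m\<close> in progress at time \<open>t\<close> ends no later
  than the sum of the bounds up to \<open>m\<close>.\<close>

lemma concatenated_steering_exists:
  assumes step: "\<And>j y. V y \<le> c j \<Longrightarrow>
    \<exists>\<tau> z. 1 \<le> \<tau> \<and> \<tau> \<le> N j \<and> steers f V (B j) \<tau> y z \<and> V z \<le> c (Suc j)"
    and y0: "V y0 \<le> c 0"
  shows "\<exists>u x. admissible_control {0..} u \<and> (\<forall>b\<ge>0. trajectory_on f 0 b y0 u x) \<and>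
    (\<forall>t\<ge>0. \<exists>m. t < (\<Sum>i\<le>m. N i) \<and> V (x t) \<le> B m)"
proof -
  \<comment> \<open>Dependent choice produces the successive end states; the clause for
    \<open>j = 0\<close> in the invariant pins the first one to \<open>y0\<close>.\<close>
  have "\<exists>y. \<forall>j. (V (y j) \<le> c j \<and> (j = 0 \<longrightarrow> y j = y0)) \<and>
      (\<exists>\<tau>. 1 \<le> \<tau> \<and> \<tau> \<le> N j \<and> steers f V (B j) \<tau> (y j) (y (Suc j)))"
  proof (rule dependent_nat_choice)
    show "\<exists>y. V y \<le> c 0 \<and> (0 = (0::nat) \<longrightarrow> y = y0)" using y0 by blast
  next
    fix y j assume "V y \<le> c j \<and> (j = 0 \<longrightarrow> y = y0)"
    then obtain \<tau> z where "1 \<le> \<tau>" "\<tau> \<le> N j" "steers f V (B j) \<tau> y z" "V z \<le> c (Suc j)"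
      using step by blast
    then show "\<exists>z. (V z \<le> c (Suc j) \<and> (Suc j = 0 \<longrightarrow> z = y0)) \<and>
        (\<exists>\<tau>. 1 \<le> \<tau> \<and> \<tau> \<le> N j \<and> steers f V (B j) \<tau> y z)"
      by blast
  qed
  then obtain y where y: "\<And>j. V (y j) \<le> c j" "y 0 = y0"
    and "\<forall>j. \<exists>\<tau>. 1 \<le> \<tau> \<and> \<tau> \<le> N j \<and> steers f V (B j) \<tau> (y j) (y (Suc j))"
    by blast
  then obtain \<tau> where \<tau>: "\<And>j. 1 \<le> \<tau> j" "\<And>j. \<tau> j \<le> N j"
    and st: "\<And>j. steers f V (B j) (\<tau> j) (y j) (y (Suc j))"
    by metis
  from st obtain u x where u: "\<And>j. admissible_control {0..\<tau> j} (u j)"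
    and x: "\<And>j. trajectory_on f 0 (\<tau> j) (y j) (u j) (x j)"
    and x_end: "\<And>j. x j (\<tau> j) = y (Suc j)"
    and B: "\<And>j s. s \<in> {0..\<tau> j} \<Longrightarrow> V (x j s) \<le> B j"
    unfolding steers_def by metis
  have x_start: "x j 0 = y j" for j
    using trajectory_on_initial[OF x] \<tau>(1)[of j] by simp
  define T where "T n = (\<Sum>i<n. \<tau> i)" for n
  have T_Suc: "T (Suc n) = \<tau> n + T n" for n
    by (simp add: T_def)
  \<comment> \<open>Durations of at least 1 make the breakpoints diverge, so the concatenation
    covers the half line.\<close>
  have T_ge: "real n \<le> T n" for n
    unfolding T_def using sum_mono[of "{..<n}" "\<lambda>_. 1" \<tau>] \<tau>(1) by simp
  have T: "time_partition T"
    unfolding time_partition_def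
  proof (intro conjI)
    show "T 0 = 0" by (simp add: T_def)
    show "strict_mono T"
      using \<tau>(1) by (intro strict_monoI_Suc) (simp add: T_Suc less_le_trans[OF zero_less_one])
    show "filterlim T at_top sequentially"
      by (rule filterlim_at_top_mono[OF filterlim_real_sequentially]) (simp add: T_ge)
  qed
  define u' where "u' j t = u j (t - T j)" for j t
  define x' where "x' j t = x j (t - T j)" for j t
  have u'_adm: "admissible_control {T j..T (Suc j)} (u' j)" for j
    using admissible_control_shift[OF u, of "- T j" j] by (simp add: u'_def[abs_def] T_Suc)
  have x'_tr: "trajectory_on f (T j) (T (Suc j)) (x' j (T j)) (u' j) (x' j)" for j
    using trajectory_on_shift[OF x, of "- T j" j] x_start
    by (simp add: u'_def[abs_def] x'_def[abs_def] T_Suc)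
  have match: "x' j (T (Suc j)) = x' (Suc j) (T (Suc j))" for j
    by (simp add: x'_def T_Suc[of j] x_end x_start)
  have "admissible_control {0..} (glue T u')"
    using T u'_adm by (rule admissible_control_glue)
  moreover have "x' 0 0 = y0"
    using y(2) x_start by (simp add: x'_def T_def)
  then have "trajectory_on f 0 b y0 (glue T u') (glue T x')" if "b \<ge> 0" for b
    using trajectory_on_glue[OF T x'_tr match that] by simp
  moreover have "\<exists>m. t < (\<Sum>i\<le>m. N i) \<and> V (glue T x' t) \<le> B m" if t: "t \<ge> 0" for t
  proof -
    obtain m where m: "T m \<le> t" "t < T (Suc m)" using time_partition_cover[OF T t] .
    have "T (Suc m) \<le> (\<Sum>i\<le>m. N i)"
      unfolding T_def lessThan_Suc_atMost by (intro sum_mono \<tau>(2))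
    moreover have "V (glue T x' t) \<le> B m"
      using glue_eq[OF T m, of x'] B[of "t - T m" m] m by (simp add: x'_def T_Suc)
    ultimately show ?thesis using m(2) by force
  qed
  ultimately show ?thesis by blast
qed

text \<open>Stage \<open>k\<close> of one fixed cascade leads from level \<open>l k\<close> to level
  \<open>l (Suc k)\<close> within time \<open>N k\<close>. A start at level \<open>k\<close> skips
  the earlier stages, hence still meets the deadlines computed for a start at level 0; so one pair
  \<open>M\<close>, \<open>S\<close> serves all levels.\<close>

lemma plan_exists:
  assumes c: "c > 0"
  shows "\<exists>M S l. antimono M \<and> M \<longlonglongrightarrow> 0 \<and> l 0 = c \<and> (\<forall>k. l k > 0) \<and>
    (\<forall>k y. V y \<le> l k \<longrightarrow> (\<exists>u x. plan M S k 0 y u x))"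
proof -
  define l where "l k = c / real (Suc k)" for k
  \<comment> \<open>\<open>M k\<close> is the overshoot bound for steering from level
    \<open>k\<close>; it tends to 0 with \<open>l k\<close> because \<open>a\<close> is continuous
    and vanishes at 0.\<close>
  define M where "M k = a (l k) + l k" for k
  have l_pos: "l k > 0" for k using c by (simp add: l_def)
  have l_mono: "l j \<le> l k" if "k \<le> j" for j k
    using that c by (auto simp: l_def intro!: divide_left_mono)
  have M_mono: "M j \<le> M k" if "k \<le> j" for j k
    unfolding M_def using that l_mono[OF that] l_pos[of j] by (intro add_mono a_mono) auto
  have l_lim: "l \<longlonglongrightarrow> 0"
    unfolding l_def by (rule LIMSEQ_Suc[OF lim_const_over_n])
  have "(\<lambda>k. a (l k)) \<longlonglongrightarrow> a 0"
    using a_continuous l_lim l_pos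
    by (intro continuous_on_tendsto_compose[OF a_continuous]) (auto intro!: always_eventually less_imp_le)
  then have M_lim: "M \<longlonglongrightarrow> 0"
    unfolding M_def using l_lim a_zero by (auto intro: tendsto_eq_intros)
  have "\<forall>k. \<exists>N. \<forall>y. V y \<le> l k \<longrightarrow>
      (\<exists>\<tau> z. 1 \<le> \<tau> \<and> \<tau> \<le> N \<and> steers f V (a (l k) + l k) \<tau> y z \<and> V z \<le> l (Suc k))"
    using l_pos l_mono by (intro allI reach_level_slowly) auto
  then obtain N where N: "\<And>k y. V y \<le> l k \<Longrightarrow>
      \<exists>\<tau> z. 1 \<le> \<tau> \<and> \<tau> \<le> N k \<and> steers f V (M k) \<tau> y z \<and> V z \<le> l (Suc k)"
    unfolding M_def by metis
  \<comment> \<open>The sublevel set contains 0, so some duration of at least 1 lies below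
    \<open>N k\<close>.\<close>
  have N_nonneg: "0 \<le> N k" for k
    using N[of 0 k] l_pos[of k] V_zero by force
  \<comment> \<open>All stages before \<open>j\<close> fit into time \<open>S j\<close>.\<close>
  define S where "S j = (\<Sum>i<j. N i)" for j
  have "\<exists>u x. plan M S k 0 y u x" if y: "V y \<le> l k" for k y
  proof -
    obtain u x where u: "admissible_control {0..} u" and x: "\<forall>b\<ge>0. trajectory_on f 0 b y u x"
      and bound: "\<And>t. t \<ge> 0 \<Longrightarrow> \<exists>m. t < (\<Sum>i\<le>m. N (k + i)) \<and> V (x t) \<le> M (k + m)"
      using concatenated_steering_exists[of "\<lambda>j. l (k + j)" "\<lambda>j. N (k + j)" "\<lambda>j. M (k + j)" y] N y
      by auto
    have "V (x t) \<le> M k \<and> (\<forall>j. S j \<le> t \<longrightarrow> V (x t) \<le> M j)" if t: "t \<ge> 0" for t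
    proof -
      obtain m where m: "t < (\<Sum>i\<le>m. N (k + i))" "V (x t) \<le> M (k + m)"
        using bound[OF t] by blast
      \<comment> \<open>If \<open>j\<close> exceeded \<open>k + m\<close>, the sum
        \<open>S j\<close> would contain the bounds of all stages up to the running one, and its
        deadline would not have passed yet.\<close>
      have "j \<le> k + m" if j: "S j \<le> t" for j
      proof (rule ccontr)
        assume "\<not> j \<le> k + m"
        have "(\<Sum>i\<le>m. N (k + i)) = sum N ((+) k ` {..m})"
          by (simp add: sum.reindex)
        also have "\<dots> \<le> S j"
          unfolding S_def using \<open>\<not> j \<le> k + m\<close> N_nonneg by (intro sum_mono2) auto
        finally show False using j m(1) by simp
      qed
      then show ?thesis
        using m(2) M_mono by (meson le_add1 order_trans)
    qed
    then have "plan M S k 0 y u x"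
      using u x by (simp add: plan_def)
    then show ?thesis by blast
  qed
  moreover have "l 0 = c" by (simp add: l_def)
  moreover have "antimono M" using M_mono by (simp add: antimono_def)
  ultimately show ?thesis
    using M_lim l_pos by blast
qed

end

section \<open>Feedback built from best plans\<close>

locale planning = stabilizable +
  fixes M S :: "nat \<Rightarrow> real"
  assumes M_antimono: "antimono M" and M_lim: "M \<longlonglongrightarrow> 0"
begin

definition has_plan :: "nat \<Rightarrow> real \<Rightarrow> 'a \<Rightarrow> bool" where
  "has_plan k s y \<longleftrightarrow> (\<exists>u x. plan M S k s y u x)"

lemma M_nonneg: "0 \<le> M k"
  using M_antimono M_lim by (metis decseq_def antimono_def decseq_ge)

lemma plan_initial: "plan M S k s y u x \<Longrightarrow> x s = y"
  unfolding plan_def by (metis order_refl trajectory_on_initial)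

lemma plan_level_mono: "plan M S k s y u x \<Longrightarrow> j \<le> k \<Longrightarrow> plan M S j s y u x"
  unfolding plan_def using antimonoD[OF M_antimono, of j k] by (meson order_trans)

lemma plan_tail:
  assumes p: "plan M S k s y u x" and s: "s \<le> s'"
  shows "plan M S k s' (x s') u x"
  unfolding plan_def
proof (intro conjI allI impI)
  have "admissible_control {s..} u" using p by (simp add: plan_def)
  then show "admissible_control {s'..} u"
    using s by (intro admissible_control_halfline) (rule admissible_control_subinterval, auto)
  show "trajectory_on f s' b (x s') u x" if "b \<ge> s'" for b
    using p s that trajectory_on_subinterval[of f s b y u x s' b] by (auto simp: plan_def)
qed (use p s in \<open>auto simp: plan_def\<close>)

text \<open>Every deadline passed at time \<open>t\<close> is also passed at time \<open>t + s\<close>.\<close>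

lemma plan_shift_to_zero:
  assumes p: "plan M S k s y u x" and s: "0 \<le> s"
  shows "plan M S k 0 y (\<lambda>t. u (t + s)) (\<lambda>t. x (t + s))"
  unfolding plan_def
proof (intro conjI allI impI)
  show "admissible_control {0..} (\<lambda>t. u (t + s))"
  proof (rule admissible_control_halfline)
    fix b :: real
    have "admissible_control {s..} u" using p by (simp add: plan_def)
    then have "admissible_control {s..b + s} u"
      by (rule admissible_control_subinterval) auto
    then show "admissible_control {0..b} (\<lambda>t. u (t + s))"
      using admissible_control_shift[of s "b + s" u s] by simp
  qed
  show "trajectory_on f 0 b y (\<lambda>t. u (t + s)) (\<lambda>t. x (t + s))" if "b \<ge> 0" for b
    using p that trajectory_on_shift[of f s "b + s" y u x s] by (auto simp: plan_def)
qed (use p s in \<open>auto simp: plan_def\<close>)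

text \<open>At the origin plans exist at every level, so there is no deepest one; resting at the
  equilibrium serves all levels at once.\<close>

lemma plan_zero: "plan M S k s 0 (\<lambda>_. 0) (\<lambda>_. 0)"
proof -
  have "admissible_control {s..} (\<lambda>_. 0)"
    by (intro admissible_control_halfline admissible_control_const)
  then show ?thesis
    unfolding plan_def by (simp add: trajectory_on_def f_zero V_zero M_nonneg)
qed

text \<open>One control has to serve all levels, since the feedback may not depend on the level
  whose bound is to be preserved. For nonzero \<open>y\<close> the levels with a plan are bounded,
  because \<open>V y \<le> M k\<close> and \<open>M\<close> tends to 0; a plan with the largest such
  index is also a plan for every smaller index.\<close>

lemma best_plan_exists:
  "\<exists>u. admissible_control {s..} u \<and> (\<forall>k. has_plan k s y \<longrightarrow> (\<exists>x. plan M S k s y u x))"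
proof (cases "\<exists>k. has_plan k s y")
  case False
  \<comment> \<open>Default for states without any plan: it keeps the feedback admissible at every
    state.\<close>
  have "admissible_control {s..} (\<lambda>_. 0)"
    by (intro admissible_control_halfline admissible_control_const)
  then show ?thesis using False by blast
next
  case True
  show ?thesis
  proof (cases "y = 0")
    case True
    then show ?thesis
      using plan_zero by (metis plan_def)
  next
    case False
    obtain K where K: "\<And>k. k \<ge> K \<Longrightarrow> M k < V y"
      using order_tendstoD(2)[OF M_lim V_pos[OF False]] by (auto simp: eventually_sequentially)
    have K_bound: "k \<le> K" if k: "has_plan k s y" for k
    proof -
      obtain u x where p: "plan M S k s y u x" using k by (auto simp: has_plan_def)
      then have "V y \<le> M k" using plan_initial[OF p] by (auto simp: plan_def)
      then show ?thesis using K[of k] by force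
    qed
    define m where "m = Greatest (\<lambda>k. has_plan k s y)"
    have m: "has_plan m s y" "\<And>k. has_plan k s y \<Longrightarrow> k \<le> m"
      unfolding m_def using \<open>\<exists>k. has_plan k s y\<close> K_bound
      by (metis GreatestI_nat, metis Greatest_le_nat)
    then obtain u x where "plan M S m s y u x" by (auto simp: has_plan_def)
    then show ?thesis
      using m(2) plan_level_mono by (metis plan_def)
  qed
qed

definition best :: "real \<Rightarrow> 'a \<Rightarrow> real \<Rightarrow> 'b" where
  "best s y = (SOME u. admissible_control {s..} u \<and> (\<forall>k. has_plan k s y \<longrightarrow> (\<exists>x. plan M S k s y u x)))"

lemma best_admissible: "admissible_control {s..} (best s y)"
  and best_plan: "has_plan k s y \<Longrightarrow> \<exists>x. plan M S k s y (best s y) x"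
  using someI_ex[OF best_plan_exists[of s y]] unfolding best_def[symmetric] by auto

text \<open>The sampling time is not an argument: \<open>glue\<close> recovers it from
  \<open>t\<close>, and \<open>y\<close> stands for the sample taken then.\<close>

definition feedback :: "(nat \<Rightarrow> real) \<Rightarrow> real \<Rightarrow> 'a \<Rightarrow> 'b" where
  "feedback T t y = glue T (\<lambda>i. best (T i) y) t"

lemma feedback_admissible:
  assumes T: "time_partition T"
  shows "admissible_control {0..} (\<lambda>t. feedback T t y)"
  unfolding feedback_def
  by (intro admissible_control_glue[OF T] admissible_control_subinterval[OF best_admissible]) auto

text \<open>The stability claims concern every closed-loop solution, so it has to be identified with
  a planned trajectory. On one sampling interval both obey the same open-loop control up to the
  right endpoint, and uniqueness applies.\<close>

lemma sampled_trajectory_step: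
  assumes T: "time_partition T" and x: "sampled_trajectory f T P (feedback T) x"
    and p: "has_plan k (T i) (x (T i))"
  obtains w where "plan M S k (T i) (x (T i)) (best (T i) (x (T i))) w"
    "\<And>t. t \<in> {T i..T (Suc i)} \<Longrightarrow> x t = w t"
proof -
  let ?u = "best (T i) (x (T i))"
  obtain w where w: "plan M S k (T i) (x (T i)) ?u w" using best_plan[OF p] by blast
  have "trajectory_on f (T i) (T (Suc i)) (x (T i)) (\<lambda>t. feedback T t (x (T i))) x"
    using x by (simp add: sampled_trajectory_def)
  then have x_tr: "trajectory_on f (T i) (T (Suc i)) (x (T i)) ?u x"
    by (rule trajectory_on_spike[where N = "{T (Suc i)}"]) (auto simp: feedback_def glue_eq[OF T, of i])
  have w_tr: "trajectory_on f (T i) (T (Suc i)) (x (T i)) ?u w"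
    using w time_partition_Suc[OF T, of i] by (auto simp: plan_def)
  have adm: "admissible_control {T i..T (Suc i)} ?u"
    by (rule admissible_control_subinterval[OF best_admissible]) auto
  show thesis
    using that[OF w] trajectory_on_unique[OF f_lipschitz adm x_tr w_tr] by blast
qed

lemma sampled_trajectory_has_plan:
  assumes T: "time_partition T" and x: "sampled_trajectory f T P (feedback T) x"
    and p: "has_plan k 0 (x 0)"
  shows "has_plan k (T i) (x (T i))"
proof (induction i)
  case 0
  show ?case using p T by (simp add: time_partition_def)
next
  case (Suc i)
  obtain w where w: "plan M S k (T i) (x (T i)) (best (T i) (x (T i))) w"
    "\<And>t. t \<in> {T i..T (Suc i)} \<Longrightarrow> x t = w t"
    using sampled_trajectory_step[OF T x Suc] by blast
  show ?case
    using plan_tail[OF w(1), of "T (Suc i)"] w(2)[of "T (Suc i)"] time_partition_Suc[OF T, of i]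
    by (auto simp: has_plan_def)
qed

lemma sampled_trajectory_bound:
  assumes T: "time_partition T" and x: "sampled_trajectory f T P (feedback T) x"
    and p: "has_plan k 0 (x 0)" and t: "t \<ge> 0"
  shows "V (x t) \<le> M k" and "S j \<le> t \<Longrightarrow> V (x t) \<le> M j"
proof -
  obtain i where i: "T i \<le> t" "t < T (Suc i)" using time_partition_cover[OF T t] .
  obtain w where w: "plan M S k (T i) (x (T i)) (best (T i) (x (T i))) w"
    "\<And>t. t \<in> {T i..T (Suc i)} \<Longrightarrow> x t = w t"
    using sampled_trajectory_step[OF T x sampled_trajectory_has_plan[OF T x p]] by blast
  show "V (x t) \<le> M k" and "S j \<le> t \<Longrightarrow> V (x t) \<le> M j"
    using w i by (auto simp: plan_def)
qed

lemma sampled_trajectory_exists: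
  assumes T: "time_partition T" and y0: "has_plan k 0 y0"
  shows "\<exists>x. sampled_trajectory f T {y. has_plan k 0 y} (feedback T) x \<and> x 0 = y0"
proof -
  define X where "X s y = (SOME x. plan M S k s y (best s y) x)" for s y
  have X: "plan M S k s y (best s y) (X s y)" if "has_plan k s y" for s y
    unfolding X_def using someI_ex[OF best_plan[OF that]] .
  have T0: "T 0 = 0" using T by (simp add: time_partition_def)
  \<comment> \<open>The samples come first, by recursion; the pieces between them are glued
    afterwards.\<close>
  define y where "y = rec_nat y0 (\<lambda>i z. X (T i) z (T (Suc i)))"
  have y_simps: "y 0 = y0" "y (Suc i) = X (T i) (y i) (T (Suc i))" for i
    by (simp_all add: y_def)
  have y_plan: "has_plan k (T i) (y i)" for i
  proof (induction i)
    case 0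
    show ?case using y0 T0 by (simp add: y_simps)
  next
    case (Suc i)
    show ?case
      using plan_tail[OF X[OF Suc], of "T (Suc i)"] time_partition_Suc[OF T, of i]
      by (auto simp: has_plan_def y_simps)
  qed
  define w where "w i = X (T i) (y i)" for i
  have w_plan: "plan M S k (T i) (y i) (best (T i) (y i)) (w i)" for i
    unfolding w_def by (rule X[OF y_plan])
  have w_start: "w i (T i) = y i" for i
    using plan_initial[OF w_plan] .
  have w_tr: "trajectory_on f (T i) (T (Suc i)) (w i (T i)) (best (T i) (y i)) (w i)" for i
    using w_plan[of i] w_start time_partition_Suc[OF T, of i] by (auto simp: plan_def)
  have match: "w i (T (Suc i)) = w (Suc i) (T (Suc i))" for i
    by (simp add: w_start y_simps) (simp add: w_def)
  let ?x = "glue T w"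
  have x_T: "?x (T i) = y i" for i
    using glue_eq[OF T order_refl time_partition_Suc[OF T]] w_start by metis
  have "sampled_trajectory f T {y. has_plan k 0 y} (feedback T) ?x"
    unfolding sampled_trajectory_def
  proof (intro allI conjI)
    fix i
    \<comment> \<open>Samples are taken at times \<open>T i\<close>, whereas the domain is described
      by plans from time 0, so the plan is moved back to time 0.\<close>
    show "?x (T i) \<in> {y. has_plan k 0 y}"
      using plan_shift_to_zero[OF w_plan time_partition_nonneg[OF T]] x_T by (auto simp: has_plan_def)
    have "trajectory_on f (T i) (T (Suc i)) (?x (T i)) (glue T (\<lambda>i. best (T i) (y i))) ?x"
      using T w_tr match by (rule trajectory_on_glue_step)
    then show "trajectory_on f (T i) (T (Suc i)) (?x (T i)) (\<lambda>t. feedback T t (?x (T i))) ?x"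
      by (rule trajectory_on_spike[where N = "{T (Suc i)}"])
        (auto simp: feedback_def glue_eq[OF T, of i] x_T)
  qed
  then show ?thesis
    using x_T[of 0] T0 y_simps(1) by auto
qed

end

section \<open>Verification of the stabilization property\<close>

context stabilizable
begin

theorem sampled_data_stabilizable: "SDF_SGAS f"
  unfolding SDF_SGAS_def
proof (intro allI impI)
  fix R :: real and T assume R: "R > 0" and T: "time_partition T"
  have "compact (V ` cball 0 R)"
    by (intro compact_continuous_image continuous_on_subset[OF V_continuous]) auto
  then obtain b where b: "\<And>y. y \<in> cball 0 R \<Longrightarrow> V y \<le> b"
    by (meson bounded_imp_bdd_above bdd_above.unfold compact_imp_bounded imageI)
  have "max b 1 > 0" by simp
  then obtain M S l where MS: "antimono M" "M \<longlonglongrightarrow> 0" and l: "l 0 = max b 1" "\<And>k. l k > 0"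
    and pl: "\<And>k y. V y \<le> l k \<Longrightarrow> \<exists>u x. plan M S k 0 y u x"
    using plan_exists by metis
  interpret planning f V a M S
    by unfold_locales (rule MS)+
  \<comment> \<open>Possession of a plan is handed on from sample to sample, whereas a sublevel set
    of \<open>V\<close> might be left through overshoot; hence this choice of domain.\<close>
  define P where "P = {y. has_plan 0 0 y}"
  have V_plan: "has_plan k 0 y" if "V y \<le> l k" for k y
    using pl[OF that] by (simp add: has_plan_def)
  have ball: "cball 0 R \<subseteq> P"
    unfolding P_def using V_plan b l(1) by (auto simp: le_max_iff_disj)
  have M_small: "\<exists>k. \<forall>y. V y \<le> M k \<longrightarrow> norm y < e" if e: "e > 0" for e
  proof -
    obtain r where r: "r > 0" "\<And>y. V y \<le> r \<Longrightarrow> norm y < e"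
      using V_small_imp_norm_small[OF e] by blast
    obtain k where "M k < r"
      using order_tendstoD(2)[OF M_lim r(1)] by (auto simp: eventually_sequentially)
    then show ?thesis using r(2) by (meson less_imp_le order_trans)
  qed
  show "\<exists>P k. 0 \<in> interior P \<and> cball 0 R \<subseteq> P \<and>
      (\<forall>x\<in>P. admissible_control {0..} (\<lambda>t. k t x)) \<and>
      (\<forall>x0\<in>P. \<exists>x. sampled_trajectory f T P k x \<and> x 0 = x0) \<and>
      (\<forall>\<epsilon>>0. \<exists>\<delta>>0. \<forall>x. sampled_trajectory f T P k x \<and> norm (x 0) \<le> \<delta> \<longrightarrow> (\<forall>t\<ge>0. norm (x t) \<le> \<epsilon>)) \<and>
      (\<forall>x. sampled_trajectory f T P k x \<longrightarrow> (x \<longlongrightarrow> 0) at_top)"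
  proof (intro exI[of _ P] exI[of _ "feedback T"] conjI)
    show "0 \<in> interior P"
      using ball R by (meson centre_in_ball ball_subset_cball interior_maximal open_ball order_trans subsetD)
    show "cball 0 R \<subseteq> P" by (rule ball)
    show "\<forall>x\<in>P. admissible_control {0..} (\<lambda>t. feedback T t x)"
      using feedback_admissible[OF T] by blast
    show "\<forall>x0\<in>P. \<exists>x. sampled_trajectory f T P (feedback T) x \<and> x 0 = x0"
      unfolding P_def using sampled_trajectory_exists[OF T] by blast
    show "\<forall>\<epsilon>>0. \<exists>\<delta>>0. \<forall>x. sampled_trajectory f T P (feedback T) x \<and> norm (x 0) \<le> \<delta> \<longrightarrow>
        (\<forall>t\<ge>0. norm (x t) \<le> \<epsilon>)"
    proof (intro allI impI)
      fix \<epsilon> :: real assume "\<epsilon> > 0"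
      then obtain k where k: "\<And>y. V y \<le> M k \<Longrightarrow> norm y < \<epsilon>" using M_small by blast
      \<comment> \<open>Near 0 the value of \<open>V\<close> is below \<open>l k\<close>, so a plan
        at level \<open>k\<close> exists, and its bound \<open>M k\<close> holds at all
        times.\<close>
      obtain \<delta> where \<delta>: "\<delta> > 0" "\<And>y. dist y 0 < \<delta> \<Longrightarrow> dist (V y) (V 0) < l k"
        using V_continuous l(2)[of k] unfolding continuous_on_iff by (metis UNIV_I)
      \<comment> \<open>Halving \<open>\<delta>\<close> turns the non-strict bound on the initial
        state into a strict one.\<close>
      have "norm (x t) \<le> \<epsilon>" if x: "sampled_trajectory f T P (feedback T) x" "norm (x 0) \<le> \<delta> / 2"
        and t: "t \<ge> 0" for x t
      proof -
        have "dist (V (x 0)) (V 0) < l k" using x(2) \<delta> by auto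
        then have "has_plan k 0 (x 0)" using V_zero by (intro V_plan) (auto simp: dist_real_def)
        then show ?thesis
          using sampled_trajectory_bound(1)[OF T x(1) _ t] k by (meson less_imp_le)
      qed
      then show "\<exists>\<delta>>0. \<forall>x. sampled_trajectory f T P (feedback T) x \<and> norm (x 0) \<le> \<delta> \<longrightarrow>
          (\<forall>t\<ge>0. norm (x t) \<le> \<epsilon>)"
        using \<delta>(1) by (intro exI[of _ "\<delta> / 2"]) auto
    qed
    show "\<forall>x. sampled_trajectory f T P (feedback T) x \<longrightarrow> (x \<longlongrightarrow> 0) at_top"
    proof (intro allI impI tendstoI)
      fix x and \<epsilon> :: real assume x: "sampled_trajectory f T P (feedback T) x" and "\<epsilon> > 0"
      then obtain k where k: "\<And>y. V y \<le> M k \<Longrightarrow> norm y < \<epsilon>" using M_small by blast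
      \<comment> \<open>A plan at level 0 already respects every deadline, so \<open>S k\<close> is
        a settling time common to all starts in \<open>P\<close>.\<close>
      have "x (T 0) \<in> P" using x by (simp add: sampled_trajectory_def)
      then have "has_plan 0 0 (x 0)" using T by (simp add: time_partition_def P_def)
      then have "norm (x t) < \<epsilon>" if "t \<ge> max 0 (S k)" for t
        using sampled_trajectory_bound(2)[OF T x, of 0 t k] that by (intro k) auto
      then show "\<forall>\<^sub>F t in at_top. dist (x t) 0 < \<epsilon>"
        using eventually_ge_at_top[of "max 0 (S k)"] by (auto elim!: eventually_mono)
    qed
  qed
qed

end

theorem proposition2:
  fixes f :: "(real ^ 'n) \<times> (real ^ 'm) \<Rightarrow> real ^ 'n"
    and V :: "real ^ 'n \<Rightarrow> real"
    and a :: "real \<Rightarrow> real"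
  assumes "local_lipschitz (UNIV :: real set) UNIV (\<lambda>_. f)"
    and "f (0, 0) = 0"
    and "continuous_on UNIV V"
    and "positive_definite V"
    and "proper_function V"
    and "class_K a"
    and "\<And>\<xi> x0. \<xi> > 0 \<Longrightarrow> x0 \<noteq> 0 \<Longrightarrow>
           \<exists>\<epsilon> u x. 0 < \<epsilon> \<and> \<epsilon> \<le> \<xi> \<and> admissible_control {0..\<epsilon>} u \<and>
             trajectory_on f 0 \<epsilon> x0 u x \<and>
             V (x \<epsilon>) < V x0 \<and> (\<forall>s\<in>{0..\<epsilon>}. V (x s) \<le> a (V x0))"
  shows "SDF_SGAS f"
proof -
  interpret stabilizable f V a
    by unfold_locales (fact assms)+
  show ?thesis by (rule sampled_data_stabilizable)
qed

end
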